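(* Let $0<t_2<\frac12$ and, for $t_0>0$, let $\vec\xi_{n,N}=(\xi_{n,N,i})_{i=1}^n$ be the zeros of the $n$-th orthonormal polynomial $q_{n,N}$ on $\mathbb C$ for the potential $$V(z)=\frac1{t_0}\big(|z|^2-t_2(z^2+\bar z^2)\big).$$ Let $x\in(0,1]$. Then, for $t_0>0$ small enough, each convergent subsequence of the sequence of measures $\delta_{\vec\xi_{n,N}}=\frac1n\sum_{i=1}^n\delta_{\xi_{n,N,i}}$ tends, for $N\to\infty$ and $\frac nN\to x$, to the measure $\sigma$ on $\mathbb R$ with $d\sigma(y)=\rho(y)\,dy$ and $$\rho(y)=\frac2{(b_1^2-b_2^2)\pi}\sqrt{b_1^2-b_2^2-y^2}\;\chi_{[-\sqrt{b_1^2-b_2^2},\sqrt{b_1^2-b_2^2}]}(y),$$ where $b_1>b_2>0$ are the half-axes of the ellipse with vanishing first exterior harmonic moment, second exterior harmonic moment $t_2$, and enclosed area $\pi xt_0$.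
   Context: The orthonormal polynomials $q_{n,N}$ ($\deg q_{n,N}=n$, positive leading coefficient) satisfy $(q_{m,N},q_{n,N})_N=\delta_{m,n}$ for $(f,g)_N=\int_{\mathbb C}\overline{f(z)}g(z)e^{-NV(z)}\,d^2z$. The limit $N\to\infty$, $\frac nN\to x$ means $N,n\to\infty$ with $|\frac nN-x|=o(\frac1N)$. Convergence of measures is weak convergence. The exterior harmonic moments of a counterclockwise closed curve $\gamma$ around the origin are $t_k=\frac1{2\pi\mathrm ik}\oint_\gamma\bar zz^{-k}\,dz$; the ellipse in question is centred at the origin with axes along the coordinate axes and all moments other than $t_2$ vanish. $\chi_A$ is the characteristic function of $A$. *)

theory Defs
  imports
    "HOL-Complex_Analysis.Complex_Analysis"
    "HOL-Probability.Probability"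
    "HOL-Computational_Algebra.Polynomial"
    "HOL-Library.Landau_Symbols"
begin

definition weighted_inner ::
  "(complex \<Rightarrow> real) \<Rightarrow> nat \<Rightarrow> (complex \<Rightarrow> complex) \<Rightarrow> (complex \<Rightarrow> complex) \<Rightarrow> complex" where
  "weighted_inner V N f g =
     (\<integral>z. cnj (f z) * g z * complex_of_real (exp (- real N * V z)) \<partial>lborel)"

text \<open>No integrability condition is needed below: the Bochner integral of a non-integrable
  function is 0, so the normalisation (value 1 for equal indices) makes every
  squared polynomial integrable against the weight.\<close>

definition orthonormal_polys :: "(complex \<Rightarrow> real) \<Rightarrow> nat \<Rightarrow> (nat \<Rightarrow> complex poly) \<Rightarrow> bool" where
  "orthonormal_polys V N q \<longleftrightarrow>
     (\<forall>n. degree (q n) = n \<and> Im (lead_coeff (q n)) = 0 \<and> Re (lead_coeff (q n)) > 0) \<and>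
     (\<forall>m n. weighted_inner V N (poly (q m)) (poly (q n)) = (if m = n then 1 else 0))"

definition quadratic_potential :: "real \<Rightarrow> real \<Rightarrow> complex \<Rightarrow> real" where
  "quadratic_potential t0 t2 z = (1 / t0) * ((cmod z)\<^sup>2 - t2 * Re (z\<^sup>2 + (cnj z)\<^sup>2))"

text \<open>Taking the real part in the potential loses nothing:\<close>

lemma quadratic_potential_complex:
  "complex_of_real (quadratic_potential t0 t2 z) =
     (1 / of_real t0) * (of_real ((cmod z)\<^sup>2) - of_real t2 * (z\<^sup>2 + (cnj z)\<^sup>2))"
  by (simp add: quadratic_potential_def complex_eq_iff power2_eq_square)

text \<open>The list of zeros has each zero repeated according to its multiplicity.\<close>

definition zero_vector :: "complex poly \<Rightarrow> nat \<Rightarrow> (nat \<Rightarrow> complex) \<Rightarrow> bool" where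
  "zero_vector p n \<xi> \<longleftrightarrow> image_mset \<xi> (mset_set {1..n}) = proots p"

definition empirical_measure :: "nat \<Rightarrow> (nat \<Rightarrow> complex) \<Rightarrow> complex measure" where
  "empirical_measure n \<xi> = distr (uniform_count_measure {1..n}) borel \<xi>"

lemma emeasure_empirical_measure:
  assumes "n > 0" "A \<in> sets borel"
  shows "emeasure (empirical_measure n \<xi>) A = ennreal ((1 / real n) * (\<Sum>i=1..n. indicator A (\<xi> i)))"
proof -
  have eq: "\<xi> -` A \<inter> {1..n} = {i \<in> {1..n}. \<xi> i \<in> A}" by auto
  have "(\<Sum>i=1..n. indicator A (\<xi> i) :: real) = real (card {i \<in> {1..n}. \<xi> i \<in> A})"
    by (simp add: indicator_def sum.If_cases Int_def conj_commute)
  moreover have "emeasure (empirical_measure n \<xi>) A = emeasure (uniform_count_measure {1..n}) (\<xi> -` A \<inter> {1..n})"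
    unfolding empirical_measure_def using assms
    by (subst emeasure_distr) (auto simp: space_uniform_count_measure measurable_def sets_uniform_count_measure)
  ultimately show ?thesis
    using assms by (subst (asm) emeasure_uniform_count_measure) (auto simp del: One_nat_def simp add: eq)
qed

definition weakly_converges :: "(nat \<Rightarrow> complex measure) \<Rightarrow> complex measure \<Rightarrow> bool" where
  "weakly_converges M \<mu> \<longleftrightarrow>
     finite_measure \<mu> \<and> sets \<mu> = sets borel \<and>
     (\<forall>f :: complex \<Rightarrow> real. continuous_on UNIV f \<longrightarrow> bounded (range f) \<longrightarrow>
        (\<lambda>k. \<integral>z. f z \<partial>M k) \<longlonglongrightarrow> (\<integral>z. f z \<partial>\<mu>))"

definition exterior_moment :: "nat \<Rightarrow> (real \<Rightarrow> complex) \<Rightarrow> complex" where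
  "exterior_moment k \<gamma> =
     1 / (2 * of_real pi * \<i> * of_nat k) * contour_integral \<gamma> (\<lambda>z. cnj z / z ^ k)"

text \<open>Counterclockwise ellipse centred at 0 with half-axis \<open>a\<close> along the real
  and \<open>b\<close> along the imaginary axis.\<close>

definition ellipse_path :: "real \<Rightarrow> real \<Rightarrow> real \<Rightarrow> complex" where
  "ellipse_path a b s = Complex (a * cos (2 * pi * s)) (b * sin (2 * pi * s))"

definition enclosed_area :: "(real \<Rightarrow> complex) \<Rightarrow> real" where
  "enclosed_area \<gamma> = measure lebesgue (inside (path_image \<gamma>))"

definition limit_density :: "real \<Rightarrow> real \<Rightarrow> real \<Rightarrow> real" where
  "limit_density b1 b2 y =
     2 / ((b1\<^sup>2 - b2\<^sup>2) * pi) * sqrt (b1\<^sup>2 - b2\<^sup>2 - y\<^sup>2) *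
     indicator {- sqrt (b1\<^sup>2 - b2\<^sup>2) .. sqrt (b1\<^sup>2 - b2\<^sup>2)} y"

text \<open>The measure with this density on the real line, regarded as a measure on the plane.\<close>

definition limit_measure :: "real \<Rightarrow> real \<Rightarrow> complex measure" where
  "limit_measure b1 b2 =
     distr (density lborel (\<lambda>y. ennreal (limit_density b1 b2 y))) borel complex_of_real"

end

theory Submission
  imports
    Defs
    "HOL-Computational_Algebra.Formal_Power_Series"
    "HOL-Computational_Algebra.Fundamental_Theorem_Algebra"
begin

text \<open>Integration by parts against the Gaussian weight shows that \<open>z g - \<kappa> g'\<close> is orthogonal to
  \<open>f\<close> whenever \<open>g\<close> is orthogonal to \<open>f'\<close>, where \<open>\<kappa> = 2 t\<^sub>2 t\<^sub>0 / (N (1 - 4 t\<^sub>2\<^sup>2))\<close>. Hence the orthonormal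
  polynomials are multiples of rescaled Hermite polynomials, whose zeros are real, simple and of modulus
  less than \<open>2 sqrt (\<kappa> n)\<close>. By Hermite's differential equation the zeros satisfy
  \<open>a = 2 \<kappa> \<Sum>\<^bsub>z \<noteq> a\<^esub> 1 / (a - z)\<close>. Multiplying by powers of \<open>a\<close> and symmetrising gives a recursion for
  the moments of the zeros, which in the limit \<open>\<kappa> \<rightarrow> 0\<close>, \<open>\<kappa> n \<rightarrow> A\<close> becomes the Catalan recursion
  \<open>m\<^bsub>k+2\<^esub> = A \<Sum>\<^bsub>l \<le> k\<^esub> m\<^sub>l m\<^bsub>k-l\<^esub>\<close> of the semicircle law of radius \<open>2 sqrt A\<close>. As the zeros stay in a
  bounded interval, convergence of moments implies weak convergence. The moment and area conditions
  on the ellipse say precisely that \<open>b\<^sub>1\<^sup>2 - b\<^sub>2\<^sup>2 = 4 A\<close>.\<close>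

section \<open>Rescaled Hermite polynomials\<close>

text \<open>For positive \<open>\<kappa>\<close> these are the monic Hermite polynomials of the
  centred Gaussian with variance \<open>\<kappa>\<close>. The raising operator z -
  \<open>\<kappa>\<close> d/dz is the one that integration by parts produces.\<close>

primrec hermite :: "real \<Rightarrow> nat \<Rightarrow> complex poly" where
  "hermite \<kappa> 0 = 1"
| "hermite \<kappa> (Suc n) = [:0, 1:] * hermite \<kappa> n - smult (of_real \<kappa>) (pderiv (hermite \<kappa> n))"

text \<open>Write H(n) for \<open>hermite \<kappa> n\<close>. Differentiating the recursion for
  H(n+2) gives H(n+1) plus the raising operator applied to H'(n+1). By induction H'(n+1) = (n+1)
  H(n), so the second term is (n+1) H(n+1). The identity turns the recursion into a three-term
  recurrence.\<close>

lemma pderiv_hermite: "pderiv (hermite \<kappa> (Suc n)) = smult (of_nat (Suc n)) (hermite \<kappa> n)"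
proof (induction n)
  case 0
  show ?case by (simp add: pderiv_pCons)
next
  case (Suc n)
  have "pderiv (hermite \<kappa> (Suc (Suc n))) =
     hermite \<kappa> (Suc n) + [:0, 1:] * pderiv (hermite \<kappa> (Suc n))
       - smult (of_real \<kappa>) (pderiv (pderiv (hermite \<kappa> (Suc n))))"
    by (subst hermite.simps(2)[of \<kappa> "Suc n"])
      (simp only: pderiv_diff pderiv_mult pderiv_smult, simp add: pderiv_pCons)
  also have "\<dots> = hermite \<kappa> (Suc n) + smult (of_nat (Suc n)) (hermite \<kappa> (Suc n))"
  proof -
    have "[:0, 1:] * smult c p - smult k (smult c p') = smult c ([:0, 1:] * p - smult k p')"
      for c k :: complex and p p' by (simp add: smult_diff_right mult.commute)
    then have "[:0, 1:] * pderiv (hermite \<kappa> (Suc n))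
        - smult (of_real \<kappa>) (pderiv (pderiv (hermite \<kappa> (Suc n)))) =
        smult (of_nat (Suc n)) (hermite \<kappa> (Suc n))"
      by (simp only: Suc.IH pderiv_smult) (simp only: hermite.simps(2))
    then show ?thesis by (simp only: add_diff_eq[symmetric])
  qed
  finally show ?case
    by (metis of_nat_Suc smult_add_left smult_1_left)
qed

lemma poly_hermite_Suc_Suc:
  "poly (hermite \<kappa> (Suc (Suc n))) z =
     z * poly (hermite \<kappa> (Suc n)) z - of_real (\<kappa> * real (Suc n)) * poly (hermite \<kappa> n) z"
  by (subst hermite.simps(2)) (simp del: hermite.simps of_nat_Suc add: pderiv_hermite)

lemma degree_hermite: "degree (hermite \<kappa> n) = n"
  and lead_coeff_hermite: "lead_coeff (hermite \<kappa> n) = 1"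
proof -
  have "degree (hermite \<kappa> n) = n \<and> lead_coeff (hermite \<kappa> n) = 1"
  proof (induction n)
    case (Suc n)
    then have nz: "hermite \<kappa> n \<noteq> 0" by auto
    have d: "degree ([:0, 1:] * hermite \<kappa> n) = Suc n"
      using Suc nz by (subst degree_mult_eq) auto
    have l: "degree (smult (of_real \<kappa>) (pderiv (hermite \<kappa> n))) < Suc n"
      using Suc degree_smult_le[of "of_real \<kappa>" "pderiv (hermite \<kappa> n)"]
      by (simp add: degree_pderiv)
    have c: "coeff (hermite \<kappa> (Suc n)) (Suc n) = 1"
      unfolding hermite.simps(2) coeff_diff coeff_eq_0[OF l] using Suc by (simp, metis)
    then have "degree (hermite \<kappa> (Suc n)) \<ge> Suc n"
      by (intro le_degree) simp
    moreover have "degree (hermite \<kappa> (Suc n)) \<le> Suc n"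
      unfolding hermite.simps(2) using d l by (intro degree_diff_le) auto
    ultimately show ?case using c by (metis antisym)
  qed simp
  then show "degree (hermite \<kappa> n) = n" "lead_coeff (hermite \<kappa> n) = 1" by auto
qed

section \<open>Simplicity, reality and size of the Hermite zeros\<close>

lemma hermite_nonzero: "hermite \<kappa> n \<noteq> 0"
  using lead_coeff_hermite[of \<kappa> n] by force

text \<open>The three-term recurrence, whose last coefficient is nonzero, would carry a common zero
  down to the constant polynomial 1.\<close>

lemma hermite_consecutive_no_common_root:
  assumes "\<kappa> > 0" "poly (hermite \<kappa> (Suc n)) z = 0"
  shows "poly (hermite \<kappa> n) z \<noteq> 0"
  using assms(2)
proof (induction n)
  case (Suc n)
  then show ?case using assms(1) poly_hermite_Suc_Suc[of \<kappa> n z]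
    by (metis (no_types, lifting) diff_zero mult_eq_0_iff mult_zero_right of_nat_0_less_iff of_real_eq_0_iff
        order_less_irrefl diff_0 neg_equal_0_iff_equal zero_less_Suc)
qed simp

lemma hermite_simple_root:
  assumes "\<kappa> > 0" "poly (hermite \<kappa> n) z = 0"
  shows "poly (pderiv (hermite \<kappa> n)) z \<noteq> 0"
proof (cases n)
  case (Suc m)
  then show ?thesis
    using hermite_consecutive_no_common_root[of \<kappa> m z] assms
    by (simp del: hermite.simps of_nat_Suc add: pderiv_hermite)
qed (use assms in simp)

text \<open>Two expressions for the derivative of \<open>hermite \<kappa> (Suc n)\<close> are
  compared: the one of \<open>pderiv_hermite\<close> and the derivative of the defining
  recursion.\<close>

lemma hermite_ode:
  "of_real \<kappa> * poly (pderiv (pderiv (hermite \<kappa> n))) z =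
     z * poly (pderiv (hermite \<kappa> n)) z - of_nat n * poly (hermite \<kappa> n) z"
proof -
  have "poly (pderiv (hermite \<kappa> (Suc n))) z = of_nat (Suc n) * poly (hermite \<kappa> n) z"
    by (simp add: pderiv_hermite del: hermite.simps of_nat_Suc)
  then show ?thesis
    by (simp add: pderiv_diff pderiv_mult pderiv_smult pderiv_pCons algebra_simps)
qed

text \<open>The ratio of consecutive polynomials satisfies \<open>r\<^sub>n\<^sub>+\<^sub>1 = z - \<kappa> (n + 1) / r\<^sub>n\<close>,
  a map preserving the upper half plane.\<close>

lemma hermite_upper_half_plane:
  assumes "\<kappa> > 0" "Im z > 0"
  shows "poly (hermite \<kappa> n) z \<noteq> 0 \<and> Im (poly (hermite \<kappa> (Suc n)) z / poly (hermite \<kappa> n) z) > 0"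
proof (induction n)
  case 0
  show ?case using assms by simp
next
  case (Suc n)
  define r where "r = poly (hermite \<kappa> (Suc n)) z / poly (hermite \<kappa> n) z"
  have r: "Im r > 0" using Suc by (simp add: r_def del: hermite.simps)
  then have nz: "poly (hermite \<kappa> (Suc n)) z \<noteq> 0" by (auto simp: r_def simp del: hermite.simps)
  have "poly (hermite \<kappa> (Suc (Suc n))) z / poly (hermite \<kappa> (Suc n)) z =
     z - of_real (\<kappa> * real (Suc n)) * inverse r"
    using nz Suc by (simp add: poly_hermite_Suc_Suc r_def field_simps del: hermite.simps)
  moreover have "Im (inverse r) \<le> 0"
    using r by (simp add: divide_nonneg_nonneg)
  then have "Im (of_real (\<kappa> * real (Suc n)) * inverse r) \<le> 0"
    using assms mult_nonneg_nonpos[of "\<kappa> * real (Suc n)" "Im (inverse r)"] by (simp del: inverse_complex.sel)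
  ultimately show ?case using nz assms by (simp del: hermite.simps)
qed

text \<open>The coefficients are real, so zeros come in conjugate pairs; excluding the upper half
  plane therefore excludes the lower one too.\<close>

lemma hermite_roots_real:
  assumes "\<kappa> > 0" "poly (hermite \<kappa> n) z = 0"
  shows "Im z = 0"
proof -
  have cn: "poly (hermite \<kappa> n) (cnj z) = cnj (poly (hermite \<kappa> n) z)"
  proof (induction n rule: induct_nat_012)
    case (ge2 n)
    then show ?case unfolding poly_hermite_Suc_Suc by simp
  qed simp_all
  show ?thesis
    using hermite_upper_half_plane[of \<kappa> z n] hermite_upper_half_plane[of \<kappa> "cnj z" n] assms cn
    by (cases "Im z" "0 :: real" rule: linorder_cases) auto
qed

text \<open>Let s = sqrt (\<open>\<kappa>\<close> n). If |z| >= 2 s, consecutive values grow at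
  least by the factor s up to index n: the recurrence bounds the next ratio below by 2 s - s^2 / s =
  s. Hence z is no zero.\<close>

lemma hermite_roots_bounded:
  assumes "\<kappa> > 0" "poly (hermite \<kappa> n) z = 0"
  shows "cmod z < 2 * sqrt (\<kappa> * real n)"
proof (rule ccontr)
  assume "\<not> ?thesis"
  moreover define s where "s = sqrt (\<kappa> * real n)"
  ultimately have z: "cmod z \<ge> 2 * s" by simp
  have "n > 0" using assms by (cases n) auto
  then have s: "s > 0" "s * s = \<kappa> * real n" using assms by (simp_all add: s_def)
  have "k < n \<Longrightarrow> cmod (poly (hermite \<kappa> (Suc k)) z) \<ge> s * cmod (poly (hermite \<kappa> k) z) \<and>
          poly (hermite \<kappa> k) z \<noteq> 0" for k
  proof (induction k)
    case 0
    show ?case using z s by simp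
  next
    case (Suc k)
    let ?p = "\<lambda>k. cmod (poly (hermite \<kappa> k) z)"
    have IH: "?p (Suc k) \<ge> s * ?p k" "?p k > 0" using Suc by (auto simp del: hermite.simps)
    then have nz: "?p (Suc k) > 0" using s by (meson less_le_trans mult_pos_pos)
    have "?p (Suc (Suc k)) \<ge> cmod (z * poly (hermite \<kappa> (Suc k)) z)
       - cmod (of_real (\<kappa> * real (Suc k)) * poly (hermite \<kappa> k) z)"
      unfolding poly_hermite_Suc_Suc by (rule norm_triangle_ineq2)
    moreover have "cmod (z * poly (hermite \<kappa> (Suc k)) z) \<ge> 2 * s * ?p (Suc k)"
      using z by (simp add: norm_mult mult_right_mono del: hermite.simps)
    moreover have "cmod (of_real (\<kappa> * real (Suc k)) * poly (hermite \<kappa> k) z) \<le> s * ?p (Suc k)"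
    proof -
      have "cmod (of_real (\<kappa> * real (Suc k)) * poly (hermite \<kappa> k) z) = \<kappa> * real (Suc k) * ?p k"
        using assms by (simp only: norm_mult norm_of_real) simp
      also have "\<dots> \<le> \<kappa> * real n * ?p k"
        using Suc.prems assms by (intro mult_right_mono mult_left_mono) auto
      also have "\<dots> = s * (s * ?p k)" using s by simp
      also have "\<dots> \<le> s * ?p (Suc k)" using IH s by (intro mult_left_mono) auto
      finally show ?thesis .
    qed
    ultimately show ?case using nz by (auto simp del: hermite.simps)
  qed
  from this[of "n - 1"] \<open>n > 0\<close> s have "cmod (poly (hermite \<kappa> n) z) > 0"
    by (metis Suc_pred' diff_less less_le_trans mult_pos_pos zero_less_norm_iff zero_less_one)
  then show False using assms by simp
qed

section \<open>Stieltjes relations and power sums of the zeros\<close>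

lemma poly_pderiv_prod_linear:
  fixes Z :: "'a :: field set"
  assumes "finite Z" "a \<notin> Z"
  shows "poly (pderiv (\<Prod>z\<in>Z. [:- z, 1:])) a = poly (\<Prod>z\<in>Z. [:- z, 1:]) a * (\<Sum>z\<in>Z. inverse (a - z))"
  using assms
proof (induction Z rule: finite_induct)
  case (insert z Z)
  then have "a - z \<noteq> 0" by auto
  then show ?case using insert
    by (simp add: pderiv_mult pderiv_pCons field_simps del: mult_pCons_left)
qed simp

text \<open>The summand \<open>z = a\<close> below contributes \<open>inverse 0 = 0\<close>.\<close>

lemma poly_pderiv2_prod_linear:
  fixes Z :: "'a :: field set"
  assumes "finite Z" "a \<in> Z"
  defines "P \<equiv> \<Prod>z\<in>Z. [:- z, 1:]"
  shows "poly (pderiv (pderiv P)) a = 2 * poly (pderiv P) a * (\<Sum>z\<in>Z. inverse (a - z))"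
proof -
  define Q where "Q = (\<Prod>z\<in>Z - {a}. [:- z, 1:])"
  \<comment> \<open>Splitting off the factor at a gives P'(a) = Q(a) and P''(a) = 2 Q'(a), so the
    logarithmic derivative of Q at a suffices.\<close>
  have P: "P = [:- a, 1:] * Q"
    unfolding P_def Q_def using assms by (simp add: prod.remove del: mult_pCons_left)
  have "poly (pderiv Q) a = poly Q a * (\<Sum>z\<in>Z - {a}. inverse (a - z))"
    unfolding Q_def using assms by (intro poly_pderiv_prod_linear) auto
  moreover have "(\<Sum>z\<in>Z. inverse (a - z)) = (\<Sum>z\<in>Z - {a}. inverse (a - z))"
    using assms by (simp add: sum.remove)
  ultimately show ?thesis
    unfolding P by (simp add: pderiv_mult pderiv_add pderiv_pCons del: mult_pCons_left)
qed

text \<open>Averaging over the exchange of a and z replaces the summand by a difference quotient of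
  a^(k+1), which is a geometric sum. On the diagonal the quotient is 0 by
  \<open>inverse 0 = 0\<close>, while the geometric sum is (k+1) a^k; this is the correction
  term.\<close>

lemma stieltjes_double_sum:
  fixes Z :: "'a :: field_char_0 set"
  assumes "finite Z"
  shows "2 * (\<Sum>a\<in>Z. \<Sum>z\<in>Z. a ^ Suc k * inverse (a - z)) =
    (\<Sum>l\<le>k. (\<Sum>a\<in>Z. a ^ l) * (\<Sum>a\<in>Z. a ^ (k - l))) - of_nat (Suc k) * (\<Sum>a\<in>Z. a ^ k)"
proof -
  let ?D = "\<Sum>a\<in>Z. \<Sum>z\<in>Z. a ^ Suc k * inverse (a - z)"
  have swap: "?D = (\<Sum>a\<in>Z. \<Sum>z\<in>Z. - (z ^ Suc k * inverse (a - z)))"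
    by (subst sum.swap, intro sum.cong refl)
      (metis inverse_minus_eq minus_diff_eq mult_minus_right minus_minus)
  have quot: "(a ^ Suc k - z ^ Suc k) * inverse (a - z) =
      (\<Sum>l\<le>k. a ^ l * z ^ (k - l)) - (if z = a then of_nat (Suc k) * a ^ k else 0)" for a z :: 'a
  proof (cases "z = a")
    case True
    have "(\<Sum>l\<le>k. a ^ l * a ^ (k - l)) = (\<Sum>l\<le>k. a ^ k)"
      by (intro sum.cong) (auto simp flip: power_add)
    then show ?thesis using True by simp
  next
    case False
    then show ?thesis
      unfolding diff_power_eq_sum by (simp add: lessThan_Suc_atMost del: power_Suc)
  qed
  have "2 * ?D = (\<Sum>a\<in>Z. \<Sum>z\<in>Z. (a ^ Suc k - z ^ Suc k) * inverse (a - z))"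
    unfolding mult_2 by (subst (2) swap) (simp add: sum.distrib[symmetric] algebra_simps del: power_Suc)
  also have "\<dots> = (\<Sum>a\<in>Z. \<Sum>z\<in>Z. \<Sum>l\<le>k. a ^ l * z ^ (k - l)) - of_nat (Suc k) * (\<Sum>a\<in>Z. a ^ k)"
    unfolding quot using assms by (simp add: sum_subtractf sum_distrib_left)
  also have "(\<Sum>a\<in>Z. \<Sum>z\<in>Z. \<Sum>l\<le>k. a ^ l * z ^ (k - l)) =
      (\<Sum>l\<le>k. (\<Sum>a\<in>Z. a ^ l) * (\<Sum>a\<in>Z. a ^ (k - l)))"
    by (simp add: sum_product sum.swap[of _ "{..k}"])
  finally show ?thesis .
qed

text \<open>Summing over a set ignores multiplicity; for positive \<open>\<kappa>\<close> the zeros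
  are simple (\<open>proots_hermite\<close>), so nothing is lost.\<close>

definition hermite_power_sum :: "real \<Rightarrow> nat \<Rightarrow> nat \<Rightarrow> complex" where
  "hermite_power_sum \<kappa> n k = (\<Sum>a\<in>{a. poly (hermite \<kappa> n) a = 0}. a ^ k)"

lemma proots_hermite:
  assumes "\<kappa> > 0"
  shows "proots (hermite \<kappa> n) = mset_set {a. poly (hermite \<kappa> n) a = 0}"
proof (rule multiset_eqI)
  fix a
  have fin: "finite {a. poly (hermite \<kappa> n) a = 0}"
    using hermite_nonzero poly_roots_finite by blast
  have "rsquarefree (hermite \<kappa> n)"
    unfolding rsquarefree_roots using hermite_simple_root[OF assms] by blast
  then have "poly (hermite \<kappa> n) a = 0 \<Longrightarrow> order a (hermite \<kappa> n) = 1"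
    using rsquarefree_root_order hermite_nonzero by blast
  then show "count (proots (hermite \<kappa> n)) a = count (mset_set {a. poly (hermite \<kappa> n) a = 0}) a"
    using hermite_nonzero[of \<kappa> n] fin by (auto simp: count_mset_set' order_0I)
qed

lemma hermite_prod_roots:
  assumes "\<kappa> > 0"
  shows "hermite \<kappa> n = (\<Prod>z\<in>{a. poly (hermite \<kappa> n) a = 0}. [:- z, 1:])"
  by (metis complex_poly_decompose_rsquarefree assms hermite_simple_root lead_coeff_hermite
      rsquarefree_roots smult_1_left)

text \<open>At a zero the differential equation reads \<open>\<kappa>\<close> H'' = a H'. Inserting
  H'' = 2 H' times the sum of inverses and cancelling the nonzero H' gives the relation.\<close>

lemma hermite_stieltjes_relation:
  assumes "\<kappa> > 0" "poly (hermite \<kappa> n) a = 0"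
  shows "a = 2 * of_real \<kappa> * (\<Sum>z\<in>{z. poly (hermite \<kappa> n) z = 0}. inverse (a - z))"
proof -
  have "finite {z. poly (hermite \<kappa> n) z = 0}"
    using hermite_nonzero poly_roots_finite by blast
  from poly_pderiv2_prod_linear[OF this, of a]
  have "poly (pderiv (pderiv (hermite \<kappa> n))) a =
     2 * poly (pderiv (hermite \<kappa> n)) a * (\<Sum>z\<in>{z. poly (hermite \<kappa> n) z = 0}. inverse (a - z))"
    using assms by (simp flip: hermite_prod_roots)
  then show ?thesis
    using hermite_ode[of \<kappa> n a] assms hermite_simple_root[OF assms] by (auto simp: algebra_simps)
qed

lemma hermite_power_sum_0:
  assumes "\<kappa> > 0"
  shows "hermite_power_sum \<kappa> n 0 = of_nat n"
proof -
  have "size (proots (hermite \<kappa> n)) = n"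
    by (simp add: size_proots_complex degree_hermite)
  then show ?thesis unfolding hermite_power_sum_def proots_hermite[OF assms] by simp
qed

text \<open>The double sum of 1 / (a - z) is antisymmetric, hence zero.\<close>

lemma hermite_power_sum_1:
  assumes "\<kappa> > 0"
  shows "hermite_power_sum \<kappa> n (Suc 0) = 0"
proof -
  let ?Z = "{a. poly (hermite \<kappa> n) a = 0}"
  let ?D = "\<Sum>a\<in>?Z. \<Sum>z\<in>?Z. inverse (a - z)"
  have "?D = (\<Sum>a\<in>?Z. \<Sum>z\<in>?Z. - inverse (a - z))"
    by (subst sum.swap, intro sum.cong refl) (metis inverse_minus_eq minus_diff_eq)
  then have "?D = - ?D" by (simp add: sum_negf)
  then have "?D = 0" by simp
  moreover have "hermite_power_sum \<kappa> n (Suc 0) =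
      (\<Sum>a\<in>?Z. 2 * of_real \<kappa> * (\<Sum>z\<in>?Z. inverse (a - z)))"
    unfolding hermite_power_sum_def by (rule sum.cong) (use assms hermite_stieltjes_relation in auto)
  ultimately show ?thesis by (simp flip: sum_distrib_left)
qed

text \<open>The Stieltjes relation at a is multiplied by a^(k+1) and summed over the zeros. After
  normalisation by n the subtracted term is only of order \<open>\<kappa>\<close>.\<close>

lemma hermite_power_sum_Suc_Suc:
  assumes "\<kappa> > 0"
  shows "hermite_power_sum \<kappa> n (Suc (Suc k)) = of_real \<kappa> *
    ((\<Sum>l\<le>k. hermite_power_sum \<kappa> n l * hermite_power_sum \<kappa> n (k - l))
       - of_nat (Suc k) * hermite_power_sum \<kappa> n k)"
proof -
  let ?Z = "{a. poly (hermite \<kappa> n) a = 0}"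
  have fin: "finite ?Z"
    using hermite_nonzero poly_roots_finite by blast
  have "hermite_power_sum \<kappa> n (Suc (Suc k)) =
      (\<Sum>a\<in>?Z. a ^ Suc k * (2 * of_real \<kappa> * (\<Sum>z\<in>?Z. inverse (a - z))))"
    unfolding hermite_power_sum_def
    by (rule sum.cong) (use assms hermite_stieltjes_relation in \<open>auto simp flip: power_Suc2\<close>)
  also have "\<dots> = of_real \<kappa> * (2 * (\<Sum>a\<in>?Z. \<Sum>z\<in>?Z. a ^ Suc k * inverse (a - z)))"
    by (simp add: sum_distrib_left mult_ac)
  finally show ?thesis
    unfolding stieltjes_double_sum[OF fin] hermite_power_sum_def .
qed

section \<open>Orthogonality with respect to the Gaussian weight\<close>

lemma
  fixes f :: "'a::euclidean_space \<Rightarrow> 'b::{banach, second_countable_topology}"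
  shows integrable_lborel_translate: "integrable lborel f \<Longrightarrow> integrable lborel (\<lambda>x. f (x + c))"
    and integral_lborel_translate:
      "f \<in> borel_measurable borel \<Longrightarrow> (\<integral>x. f (x + c) \<partial>lborel) = (\<integral>x. f x \<partial>lborel)"
proof -
  show "integrable lborel (\<lambda>x. f (x + c))" if "integrable lborel f"
  proof -
    have "integrable (distr lborel borel ((+) c)) f"
      using that by (simp add: lborel_distr_plus)
    then show ?thesis
      by (subst (asm) integrable_distr_eq) (use that in \<open>auto simp: add.commute\<close>)
  qed
  show "(\<integral>x. f (x + c) \<partial>lborel) = (\<integral>x. f x \<partial>lborel)" if "f \<in> borel_measurable borel"
  proof -
    have "(\<integral>x. f x \<partial>lborel) = (\<integral>x. f x \<partial>distr lborel borel ((+) c))"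
      by (simp add: lborel_distr_plus)
    also have "\<dots> = (\<integral>x. f (c + x) \<partial>lborel)"
      by (rule integral_distr) (use that in auto)
    finally show ?thesis by (simp add: add.commute)
  qed
qed

text \<open>Average the fundamental theorem of calculus \<open>f (x + e) - f x = \<integral>\<^sub>0\<^sup>1 g (x + s e) ds\<close> over \<open>x\<close>
  and use translation invariance on both sides.\<close>

lemma integral_directional_derivative_eq_0:
  fixes f g :: "'a::euclidean_space \<Rightarrow> 'b::euclidean_space"
  assumes deriv: "\<And>x s. ((\<lambda>s. f (x + s *\<^sub>R e)) has_vector_derivative g (x + s *\<^sub>R e)) (at s)"
    and cont: "continuous_on UNIV g"
    and f: "integrable lborel f" and g: "integrable lborel g"
  shows "(\<integral>x. g x \<partial>lborel) = 0"
proof -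
  have [measurable]: "g \<in> borel_measurable borel"
    using cont by (rule borel_measurable_continuous_onI)
  have fm: "f \<in> borel_measurable borel" using f by auto
  define h where "h = (\<lambda>s x. indicator {0..1} s *\<^sub>R g (x + s *\<^sub>R e) :: 'b)"
  have h: "integrable (lborel \<Otimes>\<^sub>M lborel) (\<lambda>(s, x). h s x)"
  proof (rule lborel_pair.Fubini_integrable)
    show "(\<lambda>(s, x). h s x) \<in> borel_measurable (lborel \<Otimes>\<^sub>M lborel)"
      unfolding h_def by measurable
    \<comment> \<open>By translation invariance the inner integral of the norm is constant in s on
      [0, 1], which gives joint integrability.\<close>
    have "(\<integral>y. norm (case (s, y) of (s, x) \<Rightarrow> h s x) \<partial>lborel) =
        indicator {0..1} s * (\<integral>x. norm (g x) \<partial>lborel)" for s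
      using integral_lborel_translate[of "\<lambda>x. norm (g x)" "s *\<^sub>R e"]
      by (simp add: h_def)
    then show "integrable lborel (\<lambda>s. \<integral>y. norm (case (s, y) of (s, x) \<Rightarrow> h s x) \<partial>lborel)"
      by simp
    show "AE s in lborel. integrable lborel (\<lambda>y. case (s, y) of (s, x) \<Rightarrow> h s x)"
      using integrable_lborel_translate[OF g] by (simp add: h_def)
  qed
  have "(\<integral>s. h s x \<partial>lborel) = f (x + e) - f x" for x
  proof -
    have "(\<integral>s. indicator {0..1} s *\<^sub>R g (x + s *\<^sub>R e) \<partial>lborel) = f (x + 1 *\<^sub>R e) - f (x + 0 *\<^sub>R e)"
      by (rule integral_FTC_Icc)
        (auto intro!: has_vector_derivative_at_within deriv continuous_intros
          continuous_on_compose2[OF cont])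
    then show ?thesis by (simp add: h_def)
  qed
  then have "(\<integral>x. (\<integral>s. h s x \<partial>lborel) \<partial>lborel) = (\<integral>x. f (x + e) - f x \<partial>lborel)"
    by simp
  also have "\<dots> = 0"
    using integrable_lborel_translate[OF f] f integral_lborel_translate[OF fm] by simp
  finally have "(\<integral>s. (\<integral>x. h s x \<partial>lborel) \<partial>lborel) = 0"
    using lborel_pair.Fubini_integral[OF h] by simp
  moreover have "(\<integral>x. h s x \<partial>lborel) = indicator {0..1} s *\<^sub>R (\<integral>x. g x \<partial>lborel)" for s
    by (simp add: h_def integral_lborel_translate)
  ultimately show ?thesis by simp
qed

section \<open>Algebra of the weighted inner product on polynomials\<close>

abbreviation weighted_inner_poly ::
  "(complex \<Rightarrow> real) \<Rightarrow> nat \<Rightarrow> complex poly \<Rightarrow> complex poly \<Rightarrow> complex" where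
  "weighted_inner_poly V N f g \<equiv> weighted_inner V N (poly f) (poly g)"

text \<open>A sequence with degrees 0, 1, 2, ... is a triangular basis: subtracting the multiple of
  \<open>q (Suc n)\<close> that matches the top coefficient lowers the degree.\<close>

lemma poly_expansion:
  fixes q :: "nat \<Rightarrow> 'a::field poly"
  assumes "\<And>n. degree (q n) = n" "\<And>n. q n \<noteq> 0" "degree p \<le> n"
  shows "\<exists>a. p = (\<Sum>j\<le>n. smult (a j) (q j))"
  using assms(3)
proof (induction n arbitrary: p)
  case 0
  obtain d where d: "q 0 = [:d:]" using assms(1)[of 0] by (rule degree_eq_zeroE)
  moreover have "d \<noteq> 0" using d assms(2)[of 0] by auto
  moreover obtain c where "p = [:c:]" using 0 by (auto elim: degree_eq_zeroE)
  ultimately show ?case by (intro exI[of _ "\<lambda>_. c / d"]) simp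
next
  case (Suc n)
  define c where "c = coeff p (Suc n) / lead_coeff (q (Suc n))"
  have "lead_coeff (q (Suc n)) \<noteq> 0" using assms(2) by simp
  then have "coeff (p - smult c (q (Suc n))) (Suc n) = 0"
    using assms(1)[of "Suc n"] by (simp add: c_def)
  moreover have "degree (p - smult c (q (Suc n))) \<le> Suc n"
    using Suc.prems assms(1)[of "Suc n"] degree_smult_le[of c "q (Suc n)"] by (intro degree_diff_le) auto
  ultimately have "degree (p - smult c (q (Suc n))) \<le> n"
    by (metis degree_0 le_SucE le_zero_eq leading_coeff_0_iff zero_le)
  then obtain a where a: "p - smult c (q (Suc n)) = (\<Sum>j\<le>n. smult (a j) (q j))"
    using Suc.IH by blast
  have "(\<Sum>j\<le>n. smult ((a(Suc n := c)) j) (q j)) = (\<Sum>j\<le>n. smult (a j) (q j))"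
    by (intro sum.cong) auto
  then have "p = (\<Sum>j\<le>Suc n. smult ((a(Suc n := c)) j) (q j))"
    using a by (simp add: algebra_simps)
  then show ?case by blast
qed

locale orthonormal_system =
  fixes V :: "complex \<Rightarrow> real" and N :: nat and q :: "nat \<Rightarrow> complex poly"
  assumes q: "orthonormal_polys V N q" and V_measurable: "V \<in> borel_measurable borel"
begin

abbreviation W where "W \<equiv> weighted_inner_poly V N"

lemma degree_q: "degree (q n) = n"
  using q by (simp add: orthonormal_polys_def)

lemma q_nonzero: "q n \<noteq> 0"
  using q by (auto simp: orthonormal_polys_def dest: spec[of _ n])

lemma W_q: "W (q m) (q n) = (if m = n then 1 else 0)"
  using q by (simp add: orthonormal_polys_def)

text \<open>Since \<open>W (q n) (q n) = 1 \<noteq> 0\<close>, the integrand cannot be non-integrable.\<close>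

lemma integrable_weighted_square:
  "integrable lborel (\<lambda>z. (cmod (poly p z))\<^sup>2 * exp (- real N * V z))"
proof -
  note V_measurable[measurable]
  have [measurable]: "poly r \<in> borel_measurable borel" for r :: "complex poly"
    by (intro borel_measurable_continuous_onI continuous_intros)
  let ?I = "\<lambda>p. integrable lborel (\<lambda>z. (cmod (poly p z))\<^sup>2 * exp (- real N * V z))"
  have q: "?I (q n)" for n
  proof -
    have "integrable lborel
        (\<lambda>z. cnj (poly (q n) z) * poly (q n) z * complex_of_real (exp (- real N * V z)))"
      using W_q[of n n] not_integrable_integral_eq unfolding weighted_inner_def by force
    then show ?thesis
      by (drule_tac integrable_norm) (simp add: norm_mult power2_eq_square)
  qed
  \<comment> \<open>Polynomials with integrable weighted square are closed under scaling and
    addition, so it suffices that the \<open>q n\<close> belong to them and span.\<close>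
  have smult: "?I (smult c p)" if "?I p" for c p
    using integrable_mult_right[OF that, of "(cmod c)\<^sup>2"]
    by (simp add: norm_mult power_mult_distrib mult.assoc)
  have add: "?I (p + r)" if "?I p" "?I r" for p r
  proof (rule Bochner_Integration.integrable_bound)
    show "integrable lborel (\<lambda>z. 2 * ((cmod (poly p z))\<^sup>2 * exp (- real N * V z))
        + 2 * ((cmod (poly r z))\<^sup>2 * exp (- real N * V z)))"
      using that by simp
    have "(cmod (poly (p + r) z))\<^sup>2 \<le> 2 * (cmod (poly p z))\<^sup>2 + 2 * (cmod (poly r z))\<^sup>2" for z
    proof -
      have "(cmod (poly (p + r) z))\<^sup>2 \<le> (cmod (poly p z) + cmod (poly r z))\<^sup>2"
        by (intro power_mono) (auto simp: norm_triangle_ineq)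
      also have "\<dots> \<le> 2 * (cmod (poly p z))\<^sup>2 + 2 * (cmod (poly r z))\<^sup>2"
        using zero_le_power2[of "cmod (poly p z) - cmod (poly r z)"]
        by (simp add: power2_eq_square algebra_simps)
      finally show ?thesis .
    qed
    then have "(cmod (poly (p + r) z))\<^sup>2 * exp (- real N * V z) \<le>
        (2 * (cmod (poly p z))\<^sup>2 + 2 * (cmod (poly r z))\<^sup>2) * exp (- real N * V z)" for z
      by (intro mult_right_mono) auto
    then show "AE z in lborel. norm ((cmod (poly (p + r) z))\<^sup>2 * exp (- real N * V z)) \<le>
        norm (2 * ((cmod (poly p z))\<^sup>2 * exp (- real N * V z))
        + 2 * ((cmod (poly r z))\<^sup>2 * exp (- real N * V z)))"
      by (intro AE_I2) (simp add: algebra_simps)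
  qed measurable
  obtain a where p: "p = (\<Sum>j\<le>degree p. smult (a j) (q j))"
    using poly_expansion[OF degree_q q_nonzero order_refl] by blast
  have "?I (\<Sum>j\<le>n. smult (a j) (q j))" for n
  proof (induction n)
    case 0
    show ?case using smult[OF q] by simp
  next
    case (Suc n)
    then show ?case using add[OF Suc smult[OF q]] by simp
  qed
  then show ?thesis by (subst p)
qed

text \<open>Additivity of the Bochner integral needs integrable mixed products; each is dominated by
  the sum of two squares.\<close>

lemma integrable_weighted:
  "integrable lborel (\<lambda>z. cnj (poly f z) * poly g z * complex_of_real (exp (- real N * V z)))"
proof (rule Bochner_Integration.integrable_bound)
  note V_measurable[measurable]
  have [measurable]: "poly r \<in> borel_measurable borel" for r :: "complex poly"
    by (intro borel_measurable_continuous_onI continuous_intros)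
  have [measurable]: "cnj \<in> borel_measurable borel"
    by (intro borel_measurable_continuous_onI continuous_intros)
  show "(\<lambda>z. cnj (poly f z) * poly g z * complex_of_real (exp (- real N * V z)))
      \<in> borel_measurable lborel" by measurable
  show "integrable lborel (\<lambda>z. (cmod (poly f z))\<^sup>2 * exp (- real N * V z)
      + (cmod (poly g z))\<^sup>2 * exp (- real N * V z))"
    by (intro Bochner_Integration.integrable_add integrable_weighted_square)
  have "cmod (poly f z) * cmod (poly g z) \<le> (cmod (poly f z))\<^sup>2 + (cmod (poly g z))\<^sup>2" for z
    using sum_squares_bound[of "cmod (poly f z)" "cmod (poly g z)"]
      mult_nonneg_nonneg[OF norm_ge_zero[of "poly f z"] norm_ge_zero[of "poly g z"]] by linarith
  from mult_right_mono[OF this, of "exp (- real N * V z)" for z]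
  show "AE z in lborel. norm (cnj (poly f z) * poly g z * complex_of_real (exp (- real N * V z)))
      \<le> norm ((cmod (poly f z))\<^sup>2 * exp (- real N * V z) + (cmod (poly g z))\<^sup>2 * exp (- real N * V z))"
    by (intro AE_I2) (simp add: norm_mult distrib_right)
qed

lemma W_add_right: "W f (g + h) = W f g + W f h"
  unfolding weighted_inner_def poly_add distrib_left distrib_right
  by (intro Bochner_Integration.integral_add integrable_weighted)

lemma W_smult_right: "W f (smult c g) = c * W f g"
  unfolding weighted_inner_def
  by (subst integral_mult_right_zero[symmetric]) (simp add: mult_ac)

lemma W_diff_right: "W f (g - h) = W f g - W f h"
proof -
  have "g - h = g + smult (- 1) h" by simp
  then show ?thesis by (simp only: W_add_right W_smult_right) simp
qed

lemma W_0_left: "W 0 f = 0"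
  by (simp add: weighted_inner_def)

lemma W_sum_right: "finite A \<Longrightarrow> W f (\<Sum>j\<in>A. g j) = (\<Sum>j\<in>A. W f (g j))"
proof (induction A rule: finite_induct)
  case (insert j A)
  then show ?case by (simp only: sum.insert[OF insert.hyps] W_add_right)
qed (simp add: weighted_inner_def)

text \<open>In the expansion of p the coefficient at \<open>q j\<close> is \<open>W (q j) p\<close>,
  which vanishes for j < n.\<close>

lemma q_unique:
  assumes "degree p = n" "p \<noteq> 0" "\<And>f. degree f < n \<Longrightarrow> W f p = 0"
  shows "\<exists>c. c \<noteq> 0 \<and> p = smult c (q n)"
proof -
  obtain a where a: "p = (\<Sum>j\<le>n. smult (a j) (q j))"
    using poly_expansion[OF degree_q q_nonzero, of p n] assms(1) by blast
  have "a j = 0" if "j < n" for j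
  proof -
    have "W (q j) p = (\<Sum>i\<le>n. a i * (if j = i then 1 else 0))"
      by (subst a) (simp add: W_sum_right W_smult_right W_q)
    also have "\<dots> = a j" using that by (simp add: if_distrib cong: if_cong)
    finally show ?thesis using assms(3)[of "q j"] that degree_q by simp
  qed
  then have "p = smult (a n) (q n)"
    by (subst a, subst lessThan_Suc_atMost[symmetric]) simp
  with assms(2) show ?thesis by (metis smult_0_left)
qed

end

section \<open>Integration by parts for the quadratic potential\<close>

lemma quadratic_potential_Re_Im:
  "quadratic_potential t0 t2 z = (1 / t0) * ((1 - 2 * t2) * (Re z)\<^sup>2 + (1 + 2 * t2) * (Im z)\<^sup>2)"
  by (simp add: quadratic_potential_def cmod_power2) (simp add: algebra_simps power2_eq_square)

lemma poly_line_derivative: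
  "((\<lambda>s. poly p (x + s *\<^sub>R e)) has_vector_derivative e * poly (pderiv p) (x + s *\<^sub>R e)) (at s)"
  for p :: "complex poly"
proof -
  have "((\<lambda>s. x + s *\<^sub>R e) has_vector_derivative e) (at s)"
    by (auto intro!: derivative_eq_intros)
  from field_vector_diff_chain_at[OF this poly_DERIV] show ?thesis by (simp add: o_def)
qed

text \<open>The derivative is computed in real coordinates and then rewritten in z and
  \<open>cnj z\<close>, so that \<open>cnj z\<close> can be absorbed into the conjugated left
  polynomial and z into the right one.\<close>

lemma quadratic_weight_line_derivative:
  "((\<lambda>s. complex_of_real (exp (- M * quadratic_potential t0 t2 (x + s *\<^sub>R e)))) has_vector_derivative
     - of_real (M / t0) * (cnj (x + s *\<^sub>R e) * (e - of_real (2 * t2) * cnj e)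
        + (x + s *\<^sub>R e) * (cnj e - of_real (2 * t2) * e))
      * of_real (exp (- M * quadratic_potential t0 t2 (x + s *\<^sub>R e)))) (at s)"
proof -
  define z where "z = x + s *\<^sub>R e"
  have zz: "Re z = Re x + s * Re e" "Im z = Im x + s * Im e" by (simp_all add: z_def)
  define D where "D = - (M / t0) * (2 * (1 - 2 * t2) * Re z * Re e + 2 * (1 + 2 * t2) * Im z * Im e)"
  have "((\<lambda>s. exp (- M * (k * (\<alpha> * (Re (x + s *\<^sub>R e))\<^sup>2 + \<beta> * (Im (x + s *\<^sub>R e))\<^sup>2)))) has_real_derivative
      - (M * k) * (2 * \<alpha> * Re z * Re e + 2 * \<beta> * Im z * Im e)
        * exp (- M * (k * (\<alpha> * (Re z)\<^sup>2 + \<beta> * (Im z)\<^sup>2)))) (at s)" for k \<alpha> \<beta>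
    by (auto intro!: derivative_eq_intros simp: zz algebra_simps)
  from this[of "1 / t0" "1 - 2 * t2" "1 + 2 * t2"]
  have "((\<lambda>s. exp (- M * quadratic_potential t0 t2 (x + s *\<^sub>R e))) has_real_derivative
      D * exp (- M * quadratic_potential t0 t2 z)) (at s)"
    unfolding quadratic_potential_Re_Im D_def by simp
  then have "((\<lambda>s. complex_of_real (exp (- M * quadratic_potential t0 t2 (x + s *\<^sub>R e)))) has_vector_derivative
      of_real (D * exp (- M * quadratic_potential t0 t2 z))) (at s)"
    by (intro has_vector_derivative_of_real) (simp add: has_real_derivative_iff_has_vector_derivative)
  moreover have "of_real (- k * (2 * (1 - 2 * t2) * Re z * Re e + 2 * (1 + 2 * t2) * Im z * Im e)) =
      - of_real k * (cnj z * (e - of_real (2 * t2) * cnj e) + z * (cnj e - of_real (2 * t2) * e))" for k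
    by (simp add: complex_eq_iff algebra_simps)
  from this[of "M / t0"] have "of_real D = - of_real (M / t0) *
      (cnj z * (e - of_real (2 * t2) * cnj e) + z * (cnj e - of_real (2 * t2) * e))"
    by (simp only: D_def)
  ultimately show ?thesis by (simp add: z_def)
qed

locale quadratic_orthonormal_system =
  orthonormal_system "quadratic_potential t0 t2" N q for t0 t2 N q +
  assumes t0: "t0 > 0" and t2: "0 < t2" "t2 < 1 / 2" and N: "N > 0"
begin

text \<open>In these parameters the weight is exp (- c (|z|^2 - \<open>\<tau>\<close> Re
  z^2)).\<close>

definition c where "c = real N / t0"
definition \<tau> where "\<tau> = 2 * t2"

lemma c_pos: "c > 0" and \<tau>: "0 < \<tau>" "\<tau> < 1"
  using t0 t2 N by (simp_all add: c_def \<tau>_def)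

text \<open>The derivative of conj f times g times the weight in direction e integrates to zero. The
  left side collects the derivatives of f and g, the right side that of the weight.\<close>

lemma integration_by_parts:
  "cnj e * W (pderiv f) g + e * W f (pderiv g) =
     of_real c * ((e - of_real \<tau> * cnj e) * W ([:0, 1:] * f) g
        + (cnj e - of_real \<tau> * e) * W f ([:0, 1:] * g))"
proof -
  define w where "w = (\<lambda>z. complex_of_real (exp (- real N * quadratic_potential t0 t2 z)))"
  define B where "B = (\<lambda>f g z. cnj (poly f z) * poly g z * w z)"
  have W: "W f g = (\<integral>z. B f g z \<partial>lborel)" for f g
    by (simp add: weighted_inner_def B_def w_def)
  have I: "integrable lborel (B f g)" for f g
    unfolding B_def w_def by (rule integrable_weighted)
  define G where "G = (\<lambda>z. cnj e * B (pderiv f) g z + e * B f (pderiv g) z -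
     of_real c * ((e - of_real \<tau> * cnj e) * B ([:0, 1:] * f) g z
        + (cnj e - of_real \<tau> * e) * B f ([:0, 1:] * g) z))"
  have "((\<lambda>s. B f g (x + s *\<^sub>R e)) has_vector_derivative G (x + s *\<^sub>R e)) (at s)" for x s
  proof -
    define z where "z = x + s *\<^sub>R e"
    have "((\<lambda>s. w (x + s *\<^sub>R e)) has_vector_derivative
        - of_real c * (cnj z * (e - of_real \<tau> * cnj e) + z * (cnj e - of_real \<tau> * e)) * w z) (at s)"
      unfolding w_def z_def c_def \<tau>_def by (rule quadratic_weight_line_derivative)
    from has_vector_derivative_mult[OF has_vector_derivative_mult[OF
          has_vector_derivative_cnj[OF poly_line_derivative] poly_line_derivative] this]
    show ?thesis
      unfolding B_def
      by (rule has_vector_derivative_eq_rhs)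
        (unfold z_def[symmetric], simp add: G_def B_def algebra_simps)
  qed
  moreover have "continuous_on UNIV G"
    unfolding G_def B_def w_def quadratic_potential_Re_Im by (intro continuous_intros)
  ultimately have "(\<integral>z. G z \<partial>lborel) = 0"
    by (rule integral_directional_derivative_eq_0)
      (auto simp: G_def intro!: I Bochner_Integration.integrable_add Bochner_Integration.integrable_diff
         integrable_mult_right)
  then show ?thesis
    unfolding G_def W
    by (simp add: I)
qed

text \<open>Direction 1 yields C + D and direction \<open>\<i>\<close> yields C - D; eliminating C
  leaves multiplication by z on the right only.\<close>

lemma W_X_right:
  "of_real (c * (1 - \<tau>\<^sup>2)) * W f ([:0, 1:] * g) = W (pderiv f) g + of_real \<tau> * W f (pderiv g)"
proof -
  define A B C D where "A = W (pderiv f) g" and "B = W f (pderiv g)"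
    and "C = W ([:0, 1:] * f) g" and "D = W f ([:0, 1:] * g)"
  note defs = this
  have 1: "A + B = of_real c * (1 - of_real \<tau>) * (C + D)"
    using integration_by_parts[of 1 f g] unfolding defs[symmetric] by (simp add: algebra_simps)
  have "\<i> * (B - A) = \<i> * (of_real c * (1 + of_real \<tau>) * (C - D))"
    using integration_by_parts[of \<i> f g] unfolding defs[symmetric] by (simp add: algebra_simps)
  then have 2: "B - A = of_real c * (1 + of_real \<tau>) * (C - D)"
    by simp
  have "2 * (of_real (c * (1 - \<tau>\<^sup>2)) * D) =
     (1 + of_real \<tau>) * (of_real c * (1 - of_real \<tau>) * (C + D))
      - (1 - of_real \<tau>) * (of_real c * (1 + of_real \<tau>) * (C - D))"
    by (simp add: power2_eq_square algebra_simps)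
  also have "\<dots> = 2 * (A + of_real \<tau> * B)"
    unfolding 1[symmetric] 2[symmetric] by (simp add: algebra_simps)
  finally have "of_real (c * (1 - \<tau>\<^sup>2)) * D = A + of_real \<tau> * B"
    by (simp only: mult_cancel_left) simp
  then show ?thesis unfolding defs .
qed

text \<open>The value for which the derivative term of the raising operator cancels
  \<open>of_real \<tau> * W f (pderiv g)\<close> in \<open>W_X_right\<close>, leaving a derivative
  on the left argument alone.\<close>

definition \<kappa> where "\<kappa> = \<tau> / (c * (1 - \<tau>\<^sup>2))"

lemma W_hermite_Suc:
  "of_real (c * (1 - \<tau>\<^sup>2)) * W f (hermite \<kappa> (Suc n)) = W (pderiv f) (hermite \<kappa> n)"
proof -
  define k where "k = c * (1 - \<tau>\<^sup>2)"
  have "k * \<kappa> = \<tau>"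
    using c_pos \<tau> abs_square_less_1[of \<tau>] by (simp add: k_def \<kappa>_def)
  then have "complex_of_real k * of_real \<kappa> = of_real \<tau>"
    by (metis of_real_mult)
  then show ?thesis
    unfolding hermite.simps(2) W_diff_right W_smult_right k_def[symmetric]
    by (simp only: right_diff_distrib W_X_right[folded k_def] mult.assoc[symmetric] add_diff_cancel_right')
qed

text \<open>Each use of \<open>W_hermite_Suc\<close> lowers the index and differentiates f; as deg f
  < n, f is annihilated before the index runs out.\<close>

lemma W_hermite_eq_0: "degree f < n \<Longrightarrow> W f (hermite \<kappa> n) = 0"
proof (induction n arbitrary: f)
  case (Suc n)
  have "W (pderiv f) (hermite \<kappa> n) = 0"
  proof (cases "degree f = 0")
    case True
    then have "pderiv f = 0" by (simp add: pderiv_eq_0_iff)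
    then show ?thesis by (simp add: W_0_left)
  next
    case False
    then show ?thesis using Suc by (intro Suc.IH) (simp add: degree_pderiv)
  qed
  moreover have "c * (1 - \<tau>\<^sup>2) \<noteq> 0"
    using c_pos \<tau> abs_square_less_1[of \<tau>] by simp
  ultimately show ?case using W_hermite_Suc[of f n] by (metis mult_eq_0_iff of_real_eq_0_iff)
qed simp

lemma proots_q: "proots (q n) = proots (hermite \<kappa> n)"
  using q_unique[of "hermite \<kappa> n" n] W_hermite_eq_0 degree_hermite hermite_nonzero
  by (metis proots_smult)

end

section \<open>Moments of the semicircle law\<close>

text \<open>The generating function of \<open>s\<close> is compared with \<open>(1 - sqrt (1 - 4 A X\<^sup>2)) / (2 A X\<^sup>2)\<close>:
  the linear recursion is the differential equation of the square root.\<close>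

lemma semicircle_moment_convolution:
  fixes s :: "nat \<Rightarrow> real"
  assumes "s 0 = 1" "s 1 = 0" "A \<noteq> 0"
    and rec: "\<And>k. (real k + 4) * s (Suc (Suc k)) = 4 * A * (real k + 1) * s k"
  shows "s (Suc (Suc k)) = A * (\<Sum>l\<le>k. s l * s (k - l))"
proof -
  define G where "G = Abs_fps s"
  \<comment> \<open>S is the candidate for the square root of D; the goal is S^2 = D.\<close>
  define S where "S = 1 - fps_const (2 * A) * (fps_X\<^sup>2 * G)"
  define D where "D = 1 - fps_const (4 * A) * (fps_X\<^sup>2 :: real fps)"
  have S0: "fps_nth S 0 = 1" and S1: "fps_nth S (Suc 0) = 0"
    and S2: "\<And>k. fps_nth S (Suc (Suc k)) = - 2 * A * s k"
    by (simp_all add: S_def G_def fps_X_power_mult_nth)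
  have D0: "fps_nth D 0 = 1" by (simp add: D_def)
  have ode: "D * fps_deriv S = - fps_const (4 * A) * (fps_X * S)"
  proof (rule fps_ext)
    fix j
    have D: "fps_nth (D * F) j = fps_nth F j - 4 * A * (if j < 2 then 0 else fps_nth F (j - 2))"
      for F j by (simp add: D_def left_diff_distrib mult.assoc fps_X_power_mult_nth)
    consider "j = 0" | "j = 1" | "j = 2" | m where "j = Suc (Suc (Suc m))"
      by (metis One_nat_def Suc_1 not0_implies_Suc)
    then show "fps_nth (D * fps_deriv S) j = fps_nth (- fps_const (4 * A) * (fps_X * S)) j"
    proof cases
      case 4
      then show ?thesis using rec[of m]
        by (simp add: D S2 algebra_simps)
    qed (use assms S0 S1 S2 D0 in \<open>simp_all add: D numeral_2_eq_2\<close>)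
  qed
  have D': "fps_deriv D = - fps_const (8 * A) * fps_X"
    by (simp add: D_def fps_deriv_power numeral_fps_const power2_eq_square algebra_simps)
  have "fps_deriv (S\<^sup>2) * D = 2 * S * (D * fps_deriv S)"
    by (simp add: fps_deriv_power power2_eq_square algebra_simps)
  also have "\<dots> = S\<^sup>2 * fps_deriv D"
    unfolding ode D' by (simp add: power2_eq_square numeral_fps_const algebra_simps)
  finally have eq: "fps_deriv (S\<^sup>2) * D = S\<^sup>2 * fps_deriv D" .
  \<comment> \<open>By the preceding equation the quotient S^2 / D has derivative zero; its constant
    term is 1.\<close>
  define U where "U = S\<^sup>2 * inverse D"
  have U: "S\<^sup>2 = U * D"
    using D0 by (simp add: U_def mult.assoc inverse_mult_eq_1)
  have "fps_deriv U * (D * D) = 0"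
    using eq unfolding U by (simp add: algebra_simps)
  then have "fps_deriv U = 0"
    using D0 by auto
  then have "U = fps_const (fps_nth U 0)"
    by (simp only: fps_deriv_eq_0_iff)
  also have "fps_nth U 0 = 1"
    using S0 D0 by (simp add: U_def power2_eq_square)
  finally have "S\<^sup>2 = D" using U by simp
  then have "fps_const (4 * A) * fps_X\<^sup>2 * (G - (1 + fps_const A * (fps_X\<^sup>2 * G\<^sup>2))) = 0"
    by (simp add: S_def D_def power2_eq_square algebra_simps numeral_fps_const)
  then have G: "G = 1 + fps_const A * (fps_X\<^sup>2 * G\<^sup>2)"
    using assms by simp
  have "s (Suc (Suc k)) = fps_nth G (Suc (Suc k))" by (simp add: G_def)
  also have "\<dots> = A * fps_nth (G * G) k"
    by (subst G) (simp add: fps_X_power_mult_nth power2_eq_square[of G])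
  finally show ?thesis by (simp add: fps_mult_nth G_def atLeast0AtMost)
qed

text \<open>The function y^m (F^2 - y^2)^(3/2) vanishes at both endpoints, so its derivative
  integrates to zero. The case m = 0 gives the first moment, m = k + 1 the recursion.\<close>

lemma integral_semicircle_power:
  fixes F :: real
  assumes "F > 0"
  defines "I \<equiv> \<lambda>k. integral {- F..F} (\<lambda>y. y ^ k * sqrt (F\<^sup>2 - y\<^sup>2))"
  shows "I 0 = pi * F\<^sup>2 / 2" "I 1 = 0"
    "(real k + 4) * I (Suc (Suc k)) = F\<^sup>2 * (real k + 1) * I k"
proof -
  have int: "(\<lambda>y. y ^ k * sqrt (F\<^sup>2 - y\<^sup>2)) integrable_on {- F..F}" for k
    by (intro integrable_continuous_real continuous_intros)
  have pos: "F\<^sup>2 - y\<^sup>2 > 0" if "y \<in> {- F<..<F}" for y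
    using that power_strict_mono[of "\<bar>y\<bar>" F 2] by (auto simp: abs_less_iff)
  have deriv: "((\<lambda>y. y ^ m * (F\<^sup>2 - y\<^sup>2) * sqrt (F\<^sup>2 - y\<^sup>2)) has_real_derivative
      (real m * y ^ (m - 1) * (F\<^sup>2 - y\<^sup>2) - 3 * y ^ Suc m) * sqrt (F\<^sup>2 - y\<^sup>2)) (at y)"
    if "y \<in> {- F<..<F}" for m y
  proof -
    define r where "r = sqrt (F\<^sup>2 - y\<^sup>2)"
    have r: "r > 0" "F\<^sup>2 - y\<^sup>2 = r * r" using pos[OF that] by (simp_all add: r_def)
    show ?thesis
      using pos[OF that]
      by (auto intro!: derivative_eq_intros simp flip: r_def)
        (use r in \<open>simp add: field_simps power2_eq_square\<close>)
  qed
  have ibp: "((\<lambda>y. (real m * y ^ (m - 1) * (F\<^sup>2 - y\<^sup>2) - 3 * y ^ Suc m) * sqrt (F\<^sup>2 - y\<^sup>2))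
      has_integral 0) {- F..F}" for m
  proof -
    have "((\<lambda>y. (real m * y ^ (m - 1) * (F\<^sup>2 - y\<^sup>2) - 3 * y ^ Suc m) * sqrt (F\<^sup>2 - y\<^sup>2))
      has_integral (F ^ m * (F\<^sup>2 - F\<^sup>2) * sqrt (F\<^sup>2 - F\<^sup>2)
         - (- F) ^ m * (F\<^sup>2 - (- F)\<^sup>2) * sqrt (F\<^sup>2 - (- F)\<^sup>2))) {- F..F}"
      using assms deriv
      by (intro fundamental_theorem_of_calculus_interior)
        (auto intro!: continuous_intros simp: has_real_derivative_iff_has_vector_derivative)
    then show ?thesis by simp
  qed
  show "I 1 = 0"
  proof -
    have "((\<lambda>y. (- 3) * (y * sqrt (F\<^sup>2 - y\<^sup>2))) has_integral 0) {- F..F}"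
      using ibp[of 0] by (simp add: mult.assoc)
    moreover have "((\<lambda>y. (- 3) * (y * sqrt (F\<^sup>2 - y\<^sup>2))) has_integral (- 3) * I 1) {- F..F}"
      using integrable_integral[OF int[of 1]] by (intro has_integral_mult_right) (simp add: I_def)
    ultimately have "(- 3) * I 1 = 0" by (rule has_integral_unique[rotated])
    then show ?thesis by simp
  qed
  show "(real k + 4) * I (Suc (Suc k)) = F\<^sup>2 * (real k + 1) * I k"
  proof -
    have "((\<lambda>y. (real (Suc k) * F\<^sup>2) * (y ^ k * sqrt (F\<^sup>2 - y\<^sup>2))
        - (real k + 4) * (y ^ Suc (Suc k) * sqrt (F\<^sup>2 - y\<^sup>2)))
        has_integral (real (Suc k) * F\<^sup>2) * I k - (real k + 4) * I (Suc (Suc k))) {- F..F}"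
      unfolding I_def by (intro has_integral_diff has_integral_mult_right integrable_integral int)
    also have "(\<lambda>y. (real (Suc k) * F\<^sup>2) * (y ^ k * sqrt (F\<^sup>2 - y\<^sup>2))
        - (real k + 4) * (y ^ Suc (Suc k) * sqrt (F\<^sup>2 - y\<^sup>2))) =
      (\<lambda>y. (real (Suc k) * y ^ (Suc k - 1) * (F\<^sup>2 - y\<^sup>2) - 3 * y ^ Suc (Suc k)) * sqrt (F\<^sup>2 - y\<^sup>2))"
      by (rule ext) (simp add: algebra_simps power2_eq_square)
    finally have "(real (Suc k) * F\<^sup>2) * I k - (real k + 4) * I (Suc (Suc k)) = 0"
      by (rule has_integral_unique[OF _ ibp[of "Suc k"]])
    then show ?thesis by (simp add: algebra_simps)
  qed
  show "I 0 = pi * F\<^sup>2 / 2"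
  proof -
    \<comment> \<open>The antiderivative with \<open>arcsin\<close> is differentiable only in the
      open interval, hence the interior form of the fundamental theorem.\<close>
    have "((\<lambda>y. sqrt (F\<^sup>2 - y\<^sup>2)) has_integral
        ((F * sqrt (F\<^sup>2 - F\<^sup>2) + F\<^sup>2 * arcsin (F / F)) / 2
          - ((- F) * sqrt (F\<^sup>2 - (- F)\<^sup>2) + F\<^sup>2 * arcsin ((- F) / F)) / 2)) {- F..F}"
    proof (rule fundamental_theorem_of_calculus_interior)
      show "continuous_on {- F..F} (\<lambda>y. (y * sqrt (F\<^sup>2 - y\<^sup>2) + F\<^sup>2 * arcsin (y / F)) / 2)"
        using assms by (intro continuous_intros) (auto simp: field_simps)
      fix y assume y: "y \<in> {- F<..<F}"
      define r where "r = sqrt (F\<^sup>2 - y\<^sup>2)"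
      have r: "r > 0" "r * r = F\<^sup>2 - y\<^sup>2" using pos[OF y] by (simp_all add: r_def)
      have q: "sqrt (1 - (y / F)\<^sup>2) = r / F"
      proof -
        have "1 - (y / F)\<^sup>2 = (F\<^sup>2 - y\<^sup>2) / F\<^sup>2" using assms by (simp add: field_simps)
        then show ?thesis using assms by (simp add: real_sqrt_divide r_def)
      qed
      have "((\<lambda>y. (y * sqrt (F\<^sup>2 - y\<^sup>2) + F\<^sup>2 * arcsin (y / F)) / 2) has_real_derivative
          sqrt (F\<^sup>2 - y\<^sup>2)) (at y)"
        using y assms pos[OF y]
        by (auto intro!: derivative_eq_intros simp: q simp flip: r_def)
          (use r in \<open>auto simp: field_simps power2_eq_square\<close>)
      then show "((\<lambda>y. (y * sqrt (F\<^sup>2 - y\<^sup>2) + F\<^sup>2 * arcsin (y / F)) / 2) has_vector_derivative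
          sqrt (F\<^sup>2 - y\<^sup>2)) (at y)"
        by (simp add: has_real_derivative_iff_has_vector_derivative)
    qed (use assms in simp)
    then show ?thesis using assms by (simp add: I_def integral_unique)
  qed
qed

section \<open>Weak convergence from moments\<close>

text \<open>Closed sets form an intersection-stable generator, and the indicator of a nonempty
  closed set is a pointwise limit of bounded continuous functions built from the distance to
  it.\<close>

lemma finite_measure_eqI_continuous:
  fixes \<mu> \<nu> :: "'a::metric_space measure"
  assumes fin: "finite_measure \<mu>" "finite_measure \<nu>"
    and sets: "sets \<mu> = sets borel" "sets \<nu> = sets borel"
    and eq: "\<And>f :: 'a \<Rightarrow> real. continuous_on UNIV f \<Longrightarrow> bounded (range f) \<Longrightarrow>
      (\<integral>z. f z \<partial>\<mu>) = (\<integral>z. f z \<partial>\<nu>)"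
  shows "\<mu> = \<nu>"
proof (rule measure_eqI_generator_eq[where E = "Collect closed" and \<Omega> = UNIV and A = "\<lambda>_. UNIV"])
  show "Int_stable (Collect closed :: 'a set set)"
    by (auto simp: Int_stable_def)
  have borel: "sets (borel :: 'a measure) = sigma_sets UNIV (Collect closed)"
    unfolding borel_eq_closed by simp
  show "sets \<mu> = sigma_sets UNIV (Collect closed)" "sets \<nu> = sigma_sets UNIV (Collect closed)"
    using sets borel by auto
  show "emeasure \<mu> UNIV \<noteq> \<infinity>" using finite_measure.emeasure_finite[OF fin(1)] by simp
  fix A :: "'a set" assume "A \<in> Collect closed"
  then have A: "closed A" by simp
  show "emeasure \<mu> A = emeasure \<nu> A"
  \<comment> \<open>The empty set is separated because \<open>infdist z {}\<close> is 0 by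
    convention, which would make the approximants constantly 1.\<close>
  proof (cases "A = {}")
    case False
    define f where "f = (\<lambda>k z. max 0 (1 - real k * infdist z A))"
    have cont: "continuous_on UNIV (f k)" for k
      unfolding f_def by (intro continuous_intros)
    have f01: "0 \<le> f k z" "f k z \<le> 1" for k z
      by (auto simp: f_def infdist_nonneg)
    have bdd: "bounded (range (f k))" for k
      using f01 by (intro boundedI[where B = 1]) auto
    have lim: "(\<lambda>k. f k z) \<longlonglongrightarrow> indicator A z" for z
    proof (cases "z \<in> A")
      case True
      then show ?thesis by (simp add: f_def)
    next
      case zA: False
      then have pos: "infdist z A > 0"
        using in_closed_iff_infdist_zero[OF A False, of z] infdist_nonneg[of z A] by simp
      have "eventually (\<lambda>k. real k * infdist z A > 1) sequentially"
        using filterlim_at_top_mult_tendsto_pos[OF tendsto_const pos filterlim_real_sequentially]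
        by (simp add: filterlim_at_top_dense mult.commute)
      then have "eventually (\<lambda>k. f k z = 0) sequentially"
        by eventually_elim (simp add: f_def)
      then show ?thesis using zA by (simp add: tendsto_eventually)
    qed
    have int_lim: "(\<lambda>k. \<integral>z. f k z \<partial>M) \<longlonglongrightarrow> measure M A"
      if M: "finite_measure M" "sets M = sets borel" for M :: "'a measure"
    proof -
      have meas: "f k \<in> borel_measurable M" for k
        using borel_measurable_continuous_onI[OF cont] M(2) measurable_cong_sets by blast
      have AM: "A \<in> sets M" using A M(2) by simp
      have "(\<lambda>k. \<integral>z. f k z \<partial>M) \<longlonglongrightarrow> (\<integral>z. indicator A z \<partial>M)"
        by (rule integral_dominated_convergence[where w = "\<lambda>_. 1"])
          (use meas AM M lim f01 finite_measure.integrable_const in auto)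
      then show ?thesis using AM by simp
    qed
    have "measure \<mu> A = measure \<nu> A"
      using int_lim[OF fin(1) sets(1)] int_lim[OF fin(2) sets(2)] eq[OF cont bdd]
      by (simp add: LIMSEQ_unique)
    then show ?thesis
      using fin by (simp add: finite_measure.emeasure_eq_measure)
  qed simp
qed auto

lemma semicircle_set_integrable:
  "set_integrable lborel {- F..F} (\<lambda>y. g y * sqrt (F\<^sup>2 - y\<^sup>2))" if "continuous_on {- F..F} g" for F :: real
  unfolding set_integrable_def
  by (intro borel_integrable_compact) (auto intro!: continuous_intros that)

text \<open>Expectation under the semicircle law of radius F, whose variance is F^2 / 4.\<close>

definition semicircle_integral :: "real \<Rightarrow> (real \<Rightarrow> real) \<Rightarrow> real" where
  "semicircle_integral F g = 2 / (F\<^sup>2 * pi) * integral {- F..F} (\<lambda>y. g y * sqrt (F\<^sup>2 - y\<^sup>2))"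

lemma semicircle_integral_power_Suc_Suc:
  assumes "F > 0"
  shows "semicircle_integral F (\<lambda>y. y ^ Suc (Suc k)) = (F\<^sup>2 / 4) *
    (\<Sum>l\<le>k. semicircle_integral F (\<lambda>y. y ^ l) * semicircle_integral F (\<lambda>y. y ^ (k - l)))"
  and semicircle_integral_1: "semicircle_integral F (\<lambda>y. 1) = 1"
  and semicircle_integral_id: "semicircle_integral F (\<lambda>y. y) = 0"
proof -
  note * = integral_semicircle_power[OF assms]
  let ?s = "\<lambda>k. semicircle_integral F (\<lambda>y. y ^ k)"
  have 0: "?s 0 = 1" and 1: "?s 1 = 0"
    using *(1) *(2) assms by (simp_all add: semicircle_integral_def mult_ac)
  then show "semicircle_integral F (\<lambda>y. 1) = 1" "semicircle_integral F (\<lambda>y. y) = 0" by simp_all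
  show "?s (Suc (Suc k)) = (F\<^sup>2 / 4) * (\<Sum>l\<le>k. ?s l * ?s (k - l))"
  proof (rule semicircle_moment_convolution[of ?s, OF 0 1])
    fix k
    show "(real k + 4) * ?s (Suc (Suc k)) = 4 * (F\<^sup>2 / 4) * (real k + 1) * ?s k"
      using arg_cong[OF *(3)[of k], of "(*) (2 / (F\<^sup>2 * pi))"]
      unfolding semicircle_integral_def by (simp only: mult_ac) simp
  qed (use assms in simp)
qed

lemma semicircle_integral_diff:
  assumes "continuous_on {- F..F} f" "continuous_on {- F..F} g"
  shows "semicircle_integral F (\<lambda>y. f y - g y) = semicircle_integral F f - semicircle_integral F g"
  unfolding semicircle_integral_def left_diff_distrib
  by (subst integral_diff)
    (auto intro!: integrable_continuous_real continuous_intros assms simp: right_diff_distrib)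

lemma semicircle_integral_polynomial:
  "semicircle_integral F (\<lambda>y. \<Sum>i\<le>d. a i * y ^ i) = (\<Sum>i\<le>d. a i * semicircle_integral F (\<lambda>y. y ^ i))"
proof -
  have "integral {- F..F} (\<lambda>y. (\<Sum>i\<le>d. a i * y ^ i) * sqrt (F\<^sup>2 - y\<^sup>2)) =
     (\<Sum>i\<le>d. integral {- F..F} (\<lambda>y. a i * (y ^ i * sqrt (F\<^sup>2 - y\<^sup>2))))"
    unfolding sum_distrib_right mult.assoc
    by (intro integral_sum integrable_continuous_real continuous_intros) auto
  then show ?thesis
    by (simp add: semicircle_integral_def sum_distrib_left mult_ac)
qed

lemma semicircle_integral_bound:
  assumes "F > 0" "continuous_on {- F..F} g" "\<And>y. y \<in> {- F..F} \<Longrightarrow> \<bar>g y\<bar> \<le> e"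
  shows "\<bar>semicircle_integral F g\<bar> \<le> e"
proof -
  have nn: "sqrt (F\<^sup>2 - y\<^sup>2) \<ge> 0" if "y \<in> {- F..F}" for y
    using that assms(1) power2_le_iff_abs_le[of F y] by (auto simp: abs_le_iff)
  have "norm (integral {- F..F} (\<lambda>y. g y * sqrt (F\<^sup>2 - y\<^sup>2))) \<le> integral {- F..F} (\<lambda>y. e * sqrt (F\<^sup>2 - y\<^sup>2))"
    using assms nn
    by (intro integral_norm_bound_integral integrable_continuous_real continuous_intros)
      (auto simp: abs_mult intro!: mult_right_mono)
  also have "\<dots> = e * (pi * F\<^sup>2 / 2)"
    using integral_semicircle_power(1)[OF assms(1)] by simp
  finally have "2 / (F\<^sup>2 * pi) * \<bar>integral {- F..F} (\<lambda>y. g y * sqrt (F\<^sup>2 - y\<^sup>2))\<bar>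
      \<le> 2 / (F\<^sup>2 * pi) * (e * (pi * F\<^sup>2 / 2))"
    by (intro mult_left_mono) auto
  then show ?thesis using assms(1) by (simp add: semicircle_integral_def abs_mult)
qed

text \<open>Weierstrass approximation reduces g to polynomials, where the moments decide. The bound
  on the points makes the approximation error uniform in k.\<close>

lemma tendsto_semicircle_integral:
  fixes y :: "nat \<Rightarrow> nat \<Rightarrow> real" and n :: "nat \<Rightarrow> nat"
  assumes F: "F > 0" and g: "continuous_on UNIV g"
    and n: "eventually (\<lambda>k. n k > 0) sequentially"
    and bound: "eventually (\<lambda>k. \<forall>i\<in>{1..n k}. \<bar>y k i\<bar> \<le> R) sequentially"
    and moments: "\<And>p. (\<lambda>k. (\<Sum>i=1..n k. y k i ^ p) / n k) \<longlonglongrightarrow> semicircle_integral F (\<lambda>y. y ^ p)"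
  shows "(\<lambda>k. (\<Sum>i=1..n k. g (y k i)) / n k) \<longlonglongrightarrow> semicircle_integral F g"
proof (rule tendstoI)
  fix e :: real assume e: "e > 0"
  \<comment> \<open>The interval must contain both the sample points and the support of the limit
    law.\<close>
  define B where "B = max R F"
  obtain h where h: "real_polynomial_function h" "\<And>x. x \<in> {- B..B} \<Longrightarrow> \<bar>g x - h x\<bar> < e / 3"
    using Stone_Weierstrass_real_polynomial_function[of "{- B..B}" g "e / 3"] g e
      continuous_on_subset by (metis compact_Icc divide_pos_pos subset_UNIV zero_less_numeral)
  then obtain a d where hs: "h = (\<lambda>x. \<Sum>i\<le>d. a i * x ^ i)"
    using real_polynomial_function_iff_sum by blast
  have hcont: "continuous_on UNIV h" unfolding hs by (intro continuous_intros)
  have avg: "(\<Sum>i=1..n k. h (y k i)) / n k = (\<Sum>j\<le>d. a j * ((\<Sum>i=1..n k. y k i ^ j) / n k))" for k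
    unfolding hs by (subst sum.swap) (simp add: sum_divide_distrib sum_distrib_left)
  have "(\<lambda>k. (\<Sum>i=1..n k. h (y k i)) / n k) \<longlonglongrightarrow> (\<Sum>j\<le>d. a j * semicircle_integral F (\<lambda>y. y ^ j))"
    unfolding avg by (intro tendsto_intros moments)
  then have "(\<lambda>k. (\<Sum>i=1..n k. h (y k i)) / n k) \<longlonglongrightarrow> semicircle_integral F h"
    unfolding hs semicircle_integral_polynomial .
  then have ev: "eventually (\<lambda>k. \<bar>(\<Sum>i=1..n k. h (y k i)) / n k - semicircle_integral F h\<bar> < e / 3) sequentially"
    using e unfolding tendsto_iff dist_real_def by (meson divide_pos_pos zero_less_numeral)
  have "\<bar>semicircle_integral F (\<lambda>x. g x - h x)\<bar> \<le> e / 3"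
  proof (rule semicircle_integral_bound[OF F])
    show "continuous_on {- F..F} (\<lambda>x. g x - h x)"
      by (intro continuous_intros continuous_on_subset[OF g] continuous_on_subset[OF hcont]) auto
    fix x assume "x \<in> {- F..F}"
    then have "x \<in> {- B..B}" by (auto simp: B_def)
    then show "\<bar>g x - h x\<bar> \<le> e / 3" using h(2) less_imp_le by blast
  qed
  then have gh: "\<bar>semicircle_integral F g - semicircle_integral F h\<bar> \<le> e / 3"
    by (subst (asm) semicircle_integral_diff)
      (auto intro: continuous_on_subset[OF g] continuous_on_subset[OF hcont])
  from ev n bound show "eventually (\<lambda>k. dist ((\<Sum>i=1..n k. g (y k i)) / n k) (semicircle_integral F g) < e) sequentially"
  proof eventually_elim
    case (elim k)
    have "\<bar>(\<Sum>i=1..n k. g (y k i) - h (y k i))\<bar> \<le> (\<Sum>i=1..n k. e / 3)"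
    proof (rule order_trans[OF sum_abs], rule sum_mono)
      fix i assume "i \<in> {1..n k}"
      then have "y k i \<in> {- B..B}" using elim(3) by (force simp: B_def)
      then show "\<bar>g (y k i) - h (y k i)\<bar> \<le> e / 3" using h(2) less_imp_le by blast
    qed
    then have "\<bar>(\<Sum>i=1..n k. g (y k i)) / n k - (\<Sum>i=1..n k. h (y k i)) / n k\<bar> \<le> e / 3"
      using elim(2) by (simp add: sum_subtractf field_simps flip: diff_divide_distrib)
    then show ?case using elim(1) gh unfolding dist_real_def by linarith
  qed
qed

lemma
  assumes b: "0 < b2" "b2 < b1"
  defines "F \<equiv> sqrt (b1\<^sup>2 - b2\<^sup>2)"
  shows finite_measure_limit_measure: "finite_measure (limit_measure b1 b2)"
    and integral_limit_measure: "continuous_on UNIV f \<Longrightarrow>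
      (\<integral>z. f z \<partial>limit_measure b1 b2) = semicircle_integral F (\<lambda>y. f (of_real y))"
proof -
  have bb: "b1\<^sup>2 - b2\<^sup>2 > 0" using b by (simp add: power_strict_mono)
  then have F: "F > 0" "F\<^sup>2 = b1\<^sup>2 - b2\<^sup>2" by (simp_all add: F_def)
  have dens: "limit_density b1 b2 y = indicator {- F..F} y *\<^sub>R (2 / (F\<^sup>2 * pi) * sqrt (F\<^sup>2 - y\<^sup>2))" for y
    using F(1) by (simp add: limit_density_def mult_ac flip: F(2))
  \<comment> \<open>In HOL \<open>sqrt\<close> is negative at negative arguments; the indicator
    removes those values.\<close>
  have nn: "limit_density b1 b2 y \<ge> 0" for y
    using F bb power2_le_iff_abs_le[of F y] unfolding dens by (auto simp: abs_le_iff indicator_def)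
  have meas [measurable]: "limit_density b1 b2 \<in> borel_measurable borel"
    unfolding dens[abs_def] by measurable
  have of_real_meas [measurable]: "complex_of_real \<in> borel_measurable borel"
    by (intro borel_measurable_continuous_onI continuous_intros)
  have int: "integrable lborel (\<lambda>y. limit_density b1 b2 y * g y)" if "continuous_on UNIV g" for g
  proof -
    have "continuous_on {- F..F} (\<lambda>y. 2 / (F\<^sup>2 * pi) * g y)"
      by (intro continuous_intros continuous_on_subset[OF that]) auto
    from semicircle_set_integrable[OF this] show ?thesis
      unfolding set_integrable_def dens by (simp add: mult_ac)
  qed
  have "integrable lborel (limit_density b1 b2)"
    using int[of "\<lambda>_. 1"] by simp
  then have "(\<integral>\<^sup>+y. ennreal (limit_density b1 b2 y) \<partial>lborel) < \<infinity>"
    using nn by (simp add: nn_integral_eq_integral)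
  then have "finite_measure (density lborel (\<lambda>y. ennreal (limit_density b1 b2 y)))"
    by (intro finite_measureI) (simp add: emeasure_density)
  then show "finite_measure (limit_measure b1 b2)"
    unfolding limit_measure_def by (rule finite_measure.finite_measure_distr) simp
  show "(\<integral>z. f z \<partial>limit_measure b1 b2) = semicircle_integral F (\<lambda>y. f (of_real y))"
    if f: "continuous_on UNIV f"
  proof -
    have [measurable]: "f \<in> borel_measurable borel" using f by (rule borel_measurable_continuous_onI)
    have fc: "continuous_on S (\<lambda>y. f (of_real y))" for S
      by (rule continuous_on_compose2[OF f]) (auto intro: continuous_intros)
    have "(\<integral>z. f z \<partial>limit_measure b1 b2) =
        (\<integral>y. f (of_real y) \<partial>density lborel (\<lambda>y. ennreal (limit_density b1 b2 y)))"
      unfolding limit_measure_def by (rule integral_distr) auto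
    also have "\<dots> = (\<integral>y. limit_density b1 b2 y *\<^sub>R f (of_real y) \<partial>lborel)"
      by (rule integral_density) (auto simp: nn)
    also have "\<dots> = (LINT y:{- F..F}|lborel. 2 / (F\<^sup>2 * pi) * f (of_real y) * sqrt (F\<^sup>2 - y\<^sup>2))"
      unfolding set_lebesgue_integral_def dens by (simp add: mult_ac)
    also have "\<dots> = integral {- F..F} (\<lambda>y. 2 / (F\<^sup>2 * pi) * f (of_real y) * sqrt (F\<^sup>2 - y\<^sup>2))"
      by (intro set_borel_integral_eq_integral semicircle_set_integrable continuous_intros fc)
    also have "\<dots> = semicircle_integral F (\<lambda>y. f (of_real y))"
      unfolding semicircle_integral_def mult.assoc by simp
    finally show ?thesis .
  qed
qed

lemma integral_empirical_measure:
  "continuous_on UNIV f \<Longrightarrow> (\<integral>z. f z \<partial>empirical_measure n \<xi>) = (\<Sum>i=1..n. f (\<xi> i)) / real n"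
  for f :: "complex \<Rightarrow> real"
proof -
  assume "continuous_on UNIV f"
  then have "f \<in> borel_measurable borel" by (rule borel_measurable_continuous_onI)
  then show ?thesis
    unfolding empirical_measure_def
    by (subst integral_distr)
      (auto simp: integral_uniform_count_measure measurable_def space_uniform_count_measure
        sets_uniform_count_measure)
qed

section \<open>The ellipse\<close>

lemma ellipse_path_cis:
  "ellipse_path a b s = of_real ((a + b) / 2) * cis (2 * pi * s) + of_real ((a - b) / 2) * cis (- (2 * pi * s))"
  by (simp add: ellipse_path_def complex_eq_iff field_simps)

text \<open>Let \<open>r = (a + b) / 2\<close>, \<open>p = (a - b) / 2\<close>. On the unit circle the ellipse is \<open>z = r u + p / u\<close>
  with \<open>cnj z = r / u + p u\<close>, and the complex conjugate of the moment integral becomes a Cauchy integral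
  of \<open>(r u\<^sup>2 + p) (r - p u\<^sup>2) / (r + p u\<^sup>2)\<^sup>2\<close>, whose denominator has no zero in the closed disc.\<close>

lemma exterior_moment_2_ellipse:
  assumes a: "a > 0" and b: "b > 0"
  shows "exterior_moment 2 (ellipse_path a b) = of_real ((a - b) / (2 * (a + b)))"
proof -
  define r p where "r = (a + b) / 2" and "p = (a - b) / 2"
  have r: "r > 0" "\<bar>p\<bar> < r" using a b by (auto simp: r_def p_def field_simps)
  have den: "of_real r + of_real p * u\<^sup>2 \<noteq> 0" if "cmod u \<le> 1" for u
  proof
    assume "of_real r + of_real p * u\<^sup>2 = 0"
    then have "of_real r = - (of_real p * u\<^sup>2)" by (simp add: eq_neg_iff_add_eq_0)
    then have "cmod (of_real r) = cmod (of_real p * u\<^sup>2)" by simp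
    then have "r = \<bar>p\<bar> * (cmod u)\<^sup>2" using r by (simp add: norm_mult norm_power)
    also have "\<dots> \<le> \<bar>p\<bar> * 1" using that by (intro mult_left_mono power_le_one) auto
    finally show False using r by simp
  qed
  define f where "f = (\<lambda>u :: complex. (of_real r * u\<^sup>2 + of_real p) * (of_real r - of_real p * u\<^sup>2)
      / (of_real r + of_real p * u\<^sup>2)\<^sup>2)"
  have "f holomorphic_on cball 0 1"
    unfolding f_def using den by (intro holomorphic_intros) auto
  from Cauchy_integral_circlepath_simple[OF this, of 0]
  have "((\<lambda>u. f u / u) has_contour_integral 2 * of_real pi * \<i> * f 0) (circlepath 0 1)"
    by simp
  then have cauchy: "((\<lambda>s. f (circlepath 0 1 s) / circlepath 0 1 s *
      vector_derivative (circlepath 0 1) (at s within {0..1})) has_integral 2 * of_real pi * \<i> * f 0) {0..1}"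
    by (simp add: has_contour_integral_def)
  \<comment> \<open>Without conjugation the denominator would contain (r u^2 + p)^2, whose zeros lie
    inside the unit disc; conjugation moves them outside.\<close>
  have "((\<lambda>s. cnj (cnj (ellipse_path a b s) / ellipse_path a b s ^ 2 *
      vector_derivative (ellipse_path a b) (at s within {0..1}))) has_integral
      - (2 * of_real pi * \<i> * f 0)) {0..1}"
  proof (rule has_integral_eq[OF _ has_integral_neg[OF cauchy]])
    fix s :: real assume s: "s \<in> {0..1}"
    define u where "u = cis (2 * pi * s)"
    have u: "u \<noteq> 0" "cmod u = 1" "cnj u = inverse u" "cis (- (2 * pi * s)) = inverse u"
      by (simp_all add: u_def cis_cnj cis_inverse)
    have cp: "circlepath 0 1 s = u"
      by (simp add: circlepath u_def cis_conv_exp mult_ac)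
    have dcp: "vector_derivative (circlepath 0 1) (at s within {0..1}) = 2 * of_real pi * \<i> * u"
      using s by (simp add: vector_derivative_circlepath01 u_def cis_conv_exp mult_ac)
    have el: "ellipse_path a b s = of_real r * u + of_real p * inverse u"
      unfolding ellipse_path_cis r_def p_def u by (simp add: u_def)
    have "(ellipse_path a b has_vector_derivative
        2 * of_real pi * \<i> * (of_real r * u - of_real p * inverse u)) (at s within {0..1})"
      unfolding has_vector_derivative_complex_iff ellipse_path_def r_def p_def u_def
      by (auto intro!: derivative_eq_intros simp: cis_inverse) (simp_all add: field_simps)
    then have del: "vector_derivative (ellipse_path a b) (at s within {0..1}) =
        2 * of_real pi * \<i> * (of_real r * u - of_real p * inverse u)"
      using s by (intro vector_derivative_within_cbox[of 0 1, simplified]) auto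
    have d: "of_real r + of_real p * u\<^sup>2 \<noteq> 0" using den u by simp
    have q: "of_real r * inverse u + of_real p * u = (of_real r + of_real p * u\<^sup>2) / u"
      "of_real r * u + of_real p * inverse u = (of_real r * u\<^sup>2 + of_real p) / u"
      "of_real r * inverse u - of_real p * u = (of_real r - of_real p * u\<^sup>2) / u"
      using u by (simp_all add: field_simps power2_eq_square)
    have "cnj (cnj (ellipse_path a b s) / ellipse_path a b s ^ 2 *
        vector_derivative (ellipse_path a b) (at s within {0..1})) =
        (of_real r * u + of_real p * inverse u) / (of_real r * inverse u + of_real p * u)\<^sup>2 *
          (- (2 * of_real pi * \<i>) * (of_real r * inverse u - of_real p * u))"
      unfolding del el by (simp add: u)
    also have "\<dots> = - (f u / u * (2 * of_real pi * \<i> * u))"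
      unfolding q f_def using u d by (simp add: power_divide) (simp add: power2_eq_square)
    finally show "- (f (circlepath 0 1 s) / circlepath 0 1 s *
        vector_derivative (circlepath 0 1) (at s within {0..1})) =
      cnj (cnj (ellipse_path a b s) / ellipse_path a b s ^ 2 *
        vector_derivative (ellipse_path a b) (at s within {0..1}))"
      unfolding cp dcp by simp
  qed
  from has_integral_cnj[THEN iffD2, OF this]
  have "contour_integral (ellipse_path a b) (\<lambda>z. cnj z / z ^ 2) = cnj (- (2 * of_real pi * \<i> * f 0))"
    by (intro contour_integral_unique) (simp add: has_contour_integral_def o_def)
  moreover have "f 0 = of_real (p / r)" using r by (simp add: f_def power2_eq_square)
  ultimately have "exterior_moment 2 (ellipse_path a b) = of_real (p / (2 * r))"
    by (simp add: exterior_moment_def)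
  also have "p / (2 * r) = (a - b) / (2 * (a + b))" using add_pos_pos[OF a b] by (simp add: r_def p_def field_simps)
  finally show ?thesis .
qed

text \<open>The ellipse is the image of the unit circle under the linear map diag(a, b). The image
  of the disc is convex, so the inside of its frontier is its interior, and areas scale by a
  b.\<close>

lemma enclosed_area_ellipse:
  assumes a: "a > 0" and b: "b > 0"
  shows "enclosed_area (ellipse_path a b) = pi * a * b"
proof -
  define T where "T = (\<lambda>z. Complex (a * Re z) (b * Im z))"
  have lin: "linear T"
    by (rule linearI) (auto simp: T_def complex_eq_iff algebra_simps)
  have inj: "inj T"
    using a b by (auto simp: inj_def T_def complex_eq_iff)
  have "ellipse_path a b = T \<circ> circlepath 0 1"
    by (auto simp: fun_eq_iff ellipse_path_def T_def circlepath complex_eq_iff Re_exp Im_exp)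
  then have "path_image (ellipse_path a b) = T ` sphere 0 1"
    by (simp add: path_image_compose)
  also have "\<dots> = T ` cball 0 1 - T ` ball 0 1"
    by (subst image_set_diff[OF inj, symmetric]) (simp add: cball_diff_eq_sphere)
  also have "\<dots> = frontier (T ` cball 0 1)"
    using closure_injective_linear_image[OF lin inj, of "cball 0 1"]
      interior_injective_linear_image[OF lin inj, of "cball 0 1"]
    by (simp add: frontier_def)
  finally have "inside (path_image (ellipse_path a b)) = interior (T ` cball 0 1)"
    using lin by (simp add: inside_frontier_eq_interior bounded_linear_image linear_conv_bounded_linear
        convex_linear_image)
  then have ins: "inside (path_image (ellipse_path a b)) = T ` ball 0 1"
    using interior_injective_linear_image[OF lin inj, of "cball 0 1"] by simp
  have borel: "T ` ball 0 1 \<in> sets borel"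
    unfolding ins[symmetric] by (metis borel_open ins interior_injective_linear_image[OF lin inj] interior_cball open_interior)
  \<comment> \<open>The scaling factor of each basis vector: a for 1 and b for the imaginary
    unit.\<close>
  define c where "c = (\<lambda>j :: complex. if j = 1 then a else b)"
  have T: "T = (\<lambda>x. 0 + (\<Sum>j\<in>Basis. (c j * (x \<bullet> j)) *\<^sub>R j))"
    by (auto simp: fun_eq_iff T_def Basis_complex_def c_def complex_eq_iff)
  have Tm: "T \<in> borel_measurable borel"
    using lin by (intro borel_measurable_continuous_onI linear_continuous_on) (simp add: linear_conv_bounded_linear)
  have "lborel = density (distr lborel borel T) (\<lambda>_. ennreal (\<Prod>j\<in>Basis. \<bar>c j\<bar>))"
    unfolding T by (rule lborel_affine_euclidean) (use a b in \<open>auto simp: c_def\<close>)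
  moreover have "(\<Prod>j\<in>Basis. \<bar>c j\<bar>) = a * b"
    using a b by (simp add: Basis_complex_def c_def complex_eq_iff)
  ultimately have L: "lborel = density (distr lborel borel T) (\<lambda>_. ennreal (a * b))" by simp
  have "emeasure lborel (T ` ball 0 1) = ennreal (a * b) * emeasure lborel (T -` T ` ball 0 1)"
    by (subst L) (use borel Tm in \<open>simp add: emeasure_density emeasure_distr nn_integral_cmult_indicator\<close>)
  also have "T -` T ` ball 0 1 = ball 0 1"
    using inj by (rule inj_vimage_image_eq)
  also have "emeasure lborel (ball 0 1 :: complex set) = ennreal pi"
    using unit_ball_vol_even[of 1] by (simp add: emeasure_ball)
  finally have "measure lborel (T ` ball 0 1) = pi * a * b"
    using a b by (simp add: measure_def enn2real_mult)
  then show ?thesis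
    unfolding enclosed_area_def ins using borel by (simp add: measure_completion)
qed

section \<open>Limit of the zeros\<close>

text \<open>Dividing the power sum recursion by n gives the Catalan recursion with coefficient
  \<open>\<kappa>\<close> n, up to a term with factor \<open>\<kappa>\<close> that tends to 0.
  Strong induction passes to the limit.\<close>

lemma hermite_moment_limit:
  assumes \<kappa>: "eventually (\<lambda>k. \<kappa> k > 0) sequentially" "\<kappa> \<longlonglongrightarrow> 0"
    and n: "filterlim n at_top sequentially" "(\<lambda>k. \<kappa> k * real (n k)) \<longlonglongrightarrow> A"
    and s: "s 0 = 1" "s 1 = 0" "\<And>p. s (Suc (Suc p)) = A * (\<Sum>l\<le>p. s l * s (p - l))"
  shows "(\<lambda>k. hermite_power_sum (\<kappa> k) (n k) p / of_nat (n k)) \<longlonglongrightarrow> of_real (s p)"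
proof (induction p rule: less_induct)
  case (less p)
  have n0: "eventually (\<lambda>k. n k > 0) sequentially"
    by (rule eventually_compose_filterlim[OF eventually_gt_at_top n(1)])
  let ?m = "\<lambda>p k. hermite_power_sum (\<kappa> k) (n k) p / of_nat (n k)"
  consider "p = 0" | "p = 1" | p' where "p = Suc (Suc p')"
    by (metis One_nat_def not0_implies_Suc)
  then show ?case
  proof cases
    case 1
    have "eventually (\<lambda>k. ?m p k = of_real (s p)) sequentially"
      using \<kappa>(1) n0 by eventually_elim (simp add: 1 hermite_power_sum_0 s)
    then show ?thesis by (rule tendsto_eventually)
  next
    case 2
    have "eventually (\<lambda>k. ?m p k = of_real (s p)) sequentially"
      using \<kappa>(1) by eventually_elim (simp add: 2 hermite_power_sum_1 s(2)[simplified])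
    then show ?thesis by (rule tendsto_eventually)
  next
    case 3
    let ?g = "\<lambda>k. of_real (\<kappa> k * real (n k)) * (\<Sum>l\<le>p'. ?m l k * ?m (p' - l) k)
        - of_real (\<kappa> k) * (of_nat (Suc p') * ?m p' k)"
    have "?g \<longlonglongrightarrow> of_real A * (\<Sum>l\<le>p'. of_real (s l) * of_real (s (p' - l)))
        - of_real 0 * (of_nat (Suc p') * of_real (s p'))"
      by (intro tendsto_intros less.IH n(2) \<kappa>(2)) (auto simp: 3)
    also have "of_real A * (\<Sum>l\<le>p'. of_real (s l) * of_real (s (p' - l)))
        - of_real 0 * (of_nat (Suc p') * of_real (s p')) = complex_of_real (s p)"
      by (simp add: 3 s(3))
    finally have g: "?g \<longlonglongrightarrow> of_real (s p)" .
    have "eventually (\<lambda>k. ?g k = ?m p k) sequentially"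
      using \<kappa>(1) n0
    proof eventually_elim
      case (elim k)
      have "(\<Sum>l\<le>p'. ?m l k * ?m (p' - l) k) =
        (\<Sum>l\<le>p'. hermite_power_sum (\<kappa> k) (n k) l * hermite_power_sum (\<kappa> k) (n k) (p' - l))
           / (of_nat (n k) * of_nat (n k))"
        by (simp add: sum_divide_distrib)
      then show ?case
        using elim by (simp add: 3 hermite_power_sum_Suc_Suc field_simps)
    qed
    with g show ?thesis by (rule Lim_transform_eventually)
  qed
qed

lemma hermite_zeros_weak_limit:
  fixes f :: "complex \<Rightarrow> real"
  assumes \<kappa>: "eventually (\<lambda>k. \<kappa> k > 0) sequentially" "\<kappa> \<longlonglongrightarrow> 0"
    and n: "filterlim n at_top sequentially" "(\<lambda>k. \<kappa> k * real (n k)) \<longlonglongrightarrow> F\<^sup>2 / 4"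
    and F: "F > 0" and f: "continuous_on UNIV f"
    and zeros: "eventually (\<lambda>k. zero_vector (hermite (\<kappa> k) (n k)) (n k) (\<xi> k)) sequentially"
  shows "(\<lambda>k. \<integral>z. f z \<partial>empirical_measure (n k) (\<xi> k))
    \<longlonglongrightarrow> semicircle_integral F (\<lambda>y. f (of_real y))"
proof -
  have n0: "eventually (\<lambda>k. n k > 0) sequentially"
    by (rule eventually_compose_filterlim[OF eventually_gt_at_top n(1)])
  have roots: "(\<forall>i\<in>{1..n k}. poly (hermite (\<kappa> k) (n k)) (\<xi> k i) = 0) \<and>
      (\<Sum>i=1..n k. \<xi> k i ^ p) = hermite_power_sum (\<kappa> k) (n k) p"
    if "\<kappa> k > 0" "zero_vector (hermite (\<kappa> k) (n k)) (n k) (\<xi> k)" for k p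
  proof -
    let ?Z = "{a. poly (hermite (\<kappa> k) (n k)) a = 0}"
    have fin: "finite ?Z" using hermite_nonzero poly_roots_finite by blast
    have eq: "image_mset (\<xi> k) (mset_set {1..n k}) = mset_set ?Z"
      using that by (simp add: zero_vector_def proots_hermite)
    from arg_cong[OF eq, of set_mset] have "\<xi> k ` {1..n k} = ?Z" using fin by simp
    moreover from arg_cong[OF eq, of "\<lambda>M. sum_mset (image_mset (\<lambda>a. a ^ p) M)"]
    have "(\<Sum>i=1..n k. \<xi> k i ^ p) = hermite_power_sum (\<kappa> k) (n k) p"
      by (simp add: hermite_power_sum_def sum_unfold_sum_mset image_mset.compositionality o_def)
    ultimately show ?thesis by blast
  qed
  \<comment> \<open>The limit F^2 / 4 lies below F^2; this crude bound confines all zeros to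
    [-2 F, 2 F].\<close>
  have bound: "eventually (\<lambda>k. \<kappa> k * real (n k) < F\<^sup>2) sequentially"
    using F by (intro order_tendstoD(2)[OF n(2)]) auto
  have real: "eventually (\<lambda>k. \<forall>i\<in>{1..n k}. \<xi> k i = of_real (Re (\<xi> k i))) sequentially"
    using \<kappa>(1) zeros
  proof eventually_elim
    case (elim k)
    show ?case
    proof
      fix i assume "i \<in> {1..n k}"
      then have "poly (hermite (\<kappa> k) (n k)) (\<xi> k i) = 0"
        using roots[OF elim, of 0] by blast
      from hermite_roots_real[OF elim(1) this] show "\<xi> k i = of_real (Re (\<xi> k i))"
        by (simp add: complex_eq_iff)
    qed
  qed
  have "(\<lambda>k. (\<Sum>i=1..n k. f (of_real (Re (\<xi> k i)))) / n k) \<longlonglongrightarrow> semicircle_integral F (\<lambda>y. f (of_real y))"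
  proof (rule tendsto_semicircle_integral[OF F _ n0, where R = "2 * F"])
    show "continuous_on UNIV (\<lambda>y. f (of_real y))"
      by (rule continuous_on_compose2[OF f]) (auto intro: continuous_intros)
    show "eventually (\<lambda>k. \<forall>i\<in>{1..n k}. \<bar>Re (\<xi> k i)\<bar> \<le> 2 * F) sequentially"
      using \<kappa>(1) zeros bound
    proof eventually_elim
      case (elim k)
      show ?case
      proof
        fix i assume "i \<in> {1..n k}"
        then have "cmod (\<xi> k i) < 2 * sqrt (\<kappa> k * real (n k))"
          using hermite_roots_bounded[OF elim(1)] roots[OF elim(1,2), of 0] by blast
        also have "sqrt (\<kappa> k * real (n k)) \<le> F"
          using elim(3) F by (intro real_le_lsqrt) auto
        finally show "\<bar>Re (\<xi> k i)\<bar> \<le> 2 * F" using abs_Re_le_cmod[of "\<xi> k i"] by linarith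
      qed
    qed
    fix p
    let ?s = "\<lambda>p. semicircle_integral F (\<lambda>y. y ^ p)"
    have lim: "(\<lambda>k. Re (hermite_power_sum (\<kappa> k) (n k) p / of_nat (n k))) \<longlonglongrightarrow> Re (of_real (?s p))"
      using semicircle_integral_1[OF F] semicircle_integral_id[OF F]
        semicircle_integral_power_Suc_Suc[OF F]
      by (intro tendsto_Re hermite_moment_limit[OF \<kappa> n]) auto
    have "eventually (\<lambda>k. Re (hermite_power_sum (\<kappa> k) (n k) p / of_nat (n k)) =
        (\<Sum>i=1..n k. Re (\<xi> k i) ^ p) / n k) sequentially"
      using \<kappa>(1) zeros real
    proof eventually_elim
      case (elim k)
      have "(\<Sum>i=1..n k. \<xi> k i ^ p) = (\<Sum>i=1..n k. of_real (Re (\<xi> k i) ^ p))"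
        using elim(3) by (intro sum.cong refl) (metis of_real_power)
      also have "\<dots> = of_real (\<Sum>i=1..n k. Re (\<xi> k i) ^ p)" by simp
      finally have "hermite_power_sum (\<kappa> k) (n k) p / of_nat (n k) =
          of_real ((\<Sum>i=1..n k. Re (\<xi> k i) ^ p) / n k)"
        using roots[OF elim(1,2)] by simp
      then show ?case by (metis Re_complex_of_real)
    qed
    from tendsto_cong[OF this] lim
    show "(\<lambda>k. (\<Sum>i=1..n k. Re (\<xi> k i) ^ p) / n k) \<longlonglongrightarrow> ?s p" by simp
  qed
  moreover have "eventually (\<lambda>k. (\<Sum>i=1..n k. f (of_real (Re (\<xi> k i)))) / n k =
      (\<integral>z. f z \<partial>empirical_measure (n k) (\<xi> k))) sequentially"
    using real
    by eventually_elim (simp add: integral_empirical_measure[OF f])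
  ultimately show ?thesis by (rule Lim_transform_eventually)
qed

text \<open>The moment gives b1 - b2 = 2 t2 (b1 + b2) and the area gives b1 b2 = v. The claim
  follows from (b1 + b2)^2 - (b1 - b2)^2 = 4 b1 b2.\<close>

lemma ellipse_focal_distance:
  assumes b: "0 < b2" "b2 < b1" and t2: "0 < t2" "t2 < 1 / 2"
    and \<gamma>: "\<gamma> = ellipse_path b1 b2 \<or> \<gamma> = ellipse_path b2 b1"
    and m: "exterior_moment 2 \<gamma> = of_real t2" and area: "enclosed_area \<gamma> = pi * v"
  shows "b1\<^sup>2 - b2\<^sup>2 = 8 * t2 * v / (1 - (2 * t2)\<^sup>2)"
proof -
  have b1: "b1 > 0" using b by simp
  \<comment> \<open>A long axis in the imaginary direction would make the second moment
    negative.\<close>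
  have "\<gamma> \<noteq> ellipse_path b2 b1"
  proof
    assume "\<gamma> = ellipse_path b2 b1"
    then have "t2 = (b2 - b1) / (2 * (b2 + b1))"
      using m exterior_moment_2_ellipse[OF b(1) b1] by (metis of_real_eq_iff)
    also have "\<dots> < 0" using b b1 by (intro divide_neg_pos) auto
    finally show False using t2 by simp
  qed
  then have \<gamma>: "\<gamma> = ellipse_path b1 b2" using \<gamma> by blast
  then have "t2 = (b1 - b2) / (2 * (b1 + b2))"
    using m exterior_moment_2_ellipse[OF b1 b(1)] by (metis of_real_eq_iff)
  then have d: "b1 - b2 = 2 * t2 * (b1 + b2)" using b b1 by (simp add: field_simps)
  have v: "b1 * b2 = v"
    using area enclosed_area_ellipse[OF b1 b(1)] \<gamma> by simp
  have "(1 - (2 * t2)\<^sup>2) * (b1\<^sup>2 - b2\<^sup>2) = (1 - (2 * t2)\<^sup>2) * ((b1 - b2) * (b1 + b2))"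
    by (simp add: power2_eq_square algebra_simps)
  also have "\<dots> = 2 * t2 * ((b1 + b2)\<^sup>2 - (2 * t2 * (b1 + b2))\<^sup>2)"
    unfolding d by (simp add: power2_eq_square algebra_simps)
  also have "\<dots> = 8 * t2 * v"
    unfolding d[symmetric] v[symmetric] by (simp add: power2_eq_square algebra_simps)
  finally have "(1 - (2 * t2)\<^sup>2) * (b1\<^sup>2 - b2\<^sup>2) = 8 * t2 * v" .
  moreover have "1 - (2 * t2)\<^sup>2 > 0" using t2 abs_square_less_1[of "2 * t2"] by simp
  ultimately show ?thesis by (simp add: field_simps)
qed

theorem proposition5p13:
  fixes t2 x :: real
  assumes "0 < t2" "t2 < 1 / 2" "0 < x" "x \<le> 1"
  shows "\<exists>T > 0. \<forall>t0. 0 < t0 \<and> t0 < T \<longrightarrow>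
    (\<forall>(q :: nat \<Rightarrow> nat \<Rightarrow> complex poly) (\<xi> :: nat \<Rightarrow> nat \<Rightarrow> nat \<Rightarrow> complex)
      (b1 :: real) (b2 :: real) (\<gamma> :: real \<Rightarrow> complex)
      (n :: nat \<Rightarrow> nat) (N :: nat \<Rightarrow> nat) (r :: nat \<Rightarrow> nat) (\<mu> :: complex measure).
      (\<forall>M > 0. orthonormal_polys (quadratic_potential t0 t2) M (q M)) \<longrightarrow>
      (\<forall>M > 0. \<forall>m. zero_vector (q M m) m (\<xi> m M)) \<longrightarrow>
      0 < b2 \<longrightarrow> b2 < b1 \<longrightarrow>
      \<gamma> = ellipse_path b1 b2 \<or> \<gamma> = ellipse_path b2 b1 \<longrightarrow>
      exterior_moment 1 \<gamma> = 0 \<longrightarrow>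
      exterior_moment 2 \<gamma> = of_real t2 \<longrightarrow>
      enclosed_area \<gamma> = pi * x * t0 \<longrightarrow>
      filterlim n at_top sequentially \<longrightarrow>
      filterlim N at_top sequentially \<longrightarrow>
      (\<lambda>k. \<bar>real (n k) / real (N k) - x\<bar>) \<in> o(\<lambda>k. 1 / real (N k)) \<longrightarrow>
      strict_mono r \<longrightarrow>
      weakly_converges (\<lambda>k. empirical_measure (n (r k)) (\<xi> (n (r k)) (N (r k)))) \<mu> \<longrightarrow>
      \<mu> = limit_measure b1 b2)"
\<comment> \<open>Any positive threshold serves as the witness; 1 is one choice.\<close>
proof (intro exI[of _ "1 :: real"] conjI allI impI; (elim conjE)?)
  fix t0 :: real and q \<xi> b1 b2 \<gamma> n N r \<mu>
  assume t0: "0 < t0"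
    and q: "\<forall>M > 0. orthonormal_polys (quadratic_potential t0 t2) M (q M)"
    and \<xi>: "\<forall>M > 0. \<forall>m. zero_vector (q M m) m (\<xi> m M)"
    and b: "0 < b2" "b2 < b1"
    and \<gamma>: "\<gamma> = ellipse_path b1 b2 \<or> \<gamma> = ellipse_path b2 b1"
    and m: "exterior_moment 2 \<gamma> = of_real t2" and area: "enclosed_area \<gamma> = pi * x * t0"
    and n: "filterlim n at_top sequentially" and N: "filterlim N at_top sequentially"
    and nN: "(\<lambda>k. \<bar>real (n k) / real (N k) - x\<bar>) \<in> o(\<lambda>k. 1 / real (N k))"
    and r: "strict_mono r"
    and weak: "weakly_converges (\<lambda>k. empirical_measure (n (r k)) (\<xi> (n (r k)) (N (r k)))) \<mu>"
  define F where "F = sqrt (b1\<^sup>2 - b2\<^sup>2)"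
  have bb: "b1\<^sup>2 - b2\<^sup>2 > 0" using b by (simp add: power_strict_mono)
  then have F: "F > 0" "F\<^sup>2 = b1\<^sup>2 - b2\<^sup>2" by (simp_all add: F_def)
  define D where "D = 1 - (2 * t2)\<^sup>2"
  \<comment> \<open>The Hermite parameter for weight index N is K / N, so its product with n tends
    to K x, which the ellipse identifies as F^2 / 4.\<close>
  define K where "K = 2 * t2 * t0 / D"
  define \<kappa>s where "\<kappa>s = (\<lambda>k. K / real (N (r k)))"
  have K: "K > 0"
    unfolding K_def D_def using assms t0 abs_square_less_1[of "2 * t2"] by (intro divide_pos_pos) auto
  have foc: "K * x = F\<^sup>2 / 4"
    using ellipse_focal_distance[OF b assms(1,2) \<gamma> m, of "x * t0", folded D_def] area F(2)
    by (simp add: K_def mult_ac)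
  have sub: "filterlim (\<lambda>k. n (r k)) at_top sequentially" "filterlim (\<lambda>k. N (r k)) at_top sequentially"
    using n N filterlim_subseq[OF r] by (auto intro: filterlim_compose)
  have N0: "eventually (\<lambda>k. N (r k) > 0) sequentially"
    by (rule eventually_compose_filterlim[OF eventually_gt_at_top sub(2)])
  have "(\<lambda>k. real (n k) / real (N k)) \<longlonglongrightarrow> x"
  proof -
    have "(\<lambda>k. 1 / real (N k)) \<longlonglongrightarrow> 0"
      by (rule real_tendsto_divide_at_top[OF tendsto_const])
        (rule filterlim_compose[OF filterlim_real_sequentially N])
    \<comment> \<open>The little-o condition with constant 1 bounds the difference by 1 / N.\<close>
    moreover have "eventually (\<lambda>k. norm (real (n k) / real (N k) - x) \<le> 1 / real (N k)) sequentially"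
      using landau_o.smallD[OF nN, of 1] by simp
    ultimately have "(\<lambda>k. real (n k) / real (N k) - x) \<longlonglongrightarrow> 0"
      by (rule Lim_null_comparison[rotated])
    then show ?thesis by (simp add: LIM_zero_iff)
  qed
  from LIMSEQ_subseq_LIMSEQ[OF this r]
  have ratio: "(\<lambda>k. real (n (r k)) / real (N (r k))) \<longlonglongrightarrow> x" by (simp add: o_def)
  have zeros: "eventually (\<lambda>k. zero_vector (hermite (\<kappa>s k) (n (r k))) (n (r k)) (\<xi> (n (r k)) (N (r k)))) sequentially"
    using N0
  proof eventually_elim
    case (elim k)
    interpret quadratic_orthonormal_system t0 t2 "N (r k)" "q (N (r k))"
    proof
      show "quadratic_potential t0 t2 \<in> borel_measurable borel"
        unfolding quadratic_potential_Re_Im[abs_def] by measurable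
    qed (use q elim t0 assms in auto)
    have "\<kappa> = K / real (N (r k))"
      using elim t0 by (simp add: \<kappa>_def K_def D_def c_def \<tau>_def)
    then show ?case
      using \<xi> elim proots_q by (simp add: zero_vector_def \<kappa>s_def)
  qed
  have lim: "(\<lambda>k. \<integral>z. f z \<partial>empirical_measure (n (r k)) (\<xi> (n (r k)) (N (r k))))
      \<longlonglongrightarrow> (\<integral>z. f z \<partial>limit_measure b1 b2)" if f: "continuous_on UNIV f" for f :: "complex \<Rightarrow> real"
    unfolding integral_limit_measure[OF b f] F_def[symmetric]
  proof (rule hermite_zeros_weak_limit[OF _ _ sub(1) _ F(1) f zeros])
    show "eventually (\<lambda>k. \<kappa>s k > 0) sequentially"
      using N0 by eventually_elim (simp add: \<kappa>s_def K)
    show "\<kappa>s \<longlonglongrightarrow> 0"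
      unfolding \<kappa>s_def by (rule real_tendsto_divide_at_top[OF tendsto_const])
        (rule filterlim_compose[OF filterlim_real_sequentially sub(2)])
    show "(\<lambda>k. \<kappa>s k * real (n (r k))) \<longlonglongrightarrow> F\<^sup>2 / 4"
      using tendsto_mult[OF tendsto_const[of K] ratio] unfolding foc by (simp add: \<kappa>s_def)
  qed
  \<comment> \<open>Integrals of bounded continuous functions along the subsequence converge to
    their values under both measures, so the two measures coincide.\<close>
  show "\<mu> = limit_measure b1 b2"
  proof (rule finite_measure_eqI_continuous)
    show "finite_measure \<mu>" "sets \<mu> = sets borel"
      using weak by (auto simp: weakly_converges_def)
    show "finite_measure (limit_measure b1 b2)" by (rule finite_measure_limit_measure[OF b])
    show "sets (limit_measure b1 b2) = sets borel" by (simp add: limit_measure_def)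
    fix f :: "complex \<Rightarrow> real" assume f: "continuous_on UNIV f" "bounded (range f)"
    then have "(\<lambda>k. \<integral>z. f z \<partial>empirical_measure (n (r k)) (\<xi> (n (r k)) (N (r k)))) \<longlonglongrightarrow> (\<integral>z. f z \<partial>\<mu>)"
      using weak by (auto simp: weakly_converges_def)
    with lim[OF f(1)] show "(\<integral>z. f z \<partial>\<mu>) = (\<integral>z. f z \<partial>limit_measure b1 b2)"
      using LIMSEQ_unique by blast
  qed
qed simp

end
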